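(* Let $(\mathcal X,\mathfrak S)$ be a relatively hierarchically hyperbolic space. Then there exists $D\ge0$ such that for all $x,y\in\mathcal X$ there exists a $(D,D)$-quasigeodesic $\gamma$ in $\mathcal X$ joining $x,y$ so that $\pi_U(\gamma)$ is an unparameterized $(D,D)$-quasigeodesic for each $U\in\mathfrak S$.
   Context: A $(D,D)$-quasigeodesic in a metric space $M$ is a $(D,D)$-quasi-isometric embedding $f:[0,\ell]\to M$, where $f$ may be a coarse map (sending points to uniformly bounded sets). A (coarse) map $f:[0,\ell]\to M$ is an unparameterized $(D,D)$-quasigeodesic if there is a strictly increasing $g:[0,L]\to[0,\ell]$ with $g(0)=0$, $g(L)=\ell$ such that $f\circ g:[0,L]\to M$ is a $(D,D)$-quasigeodesic and $\mathrm{diam}_M(f(g(j))\cup f(g(j+1)))\le D$ for each $j\in[0,L]\cap\mathbb N$ (with $j+1\le L$). Hierarchical spaces. A $q$-quasigeodesic space is a metric space in which any two points are joined by a $(q,q)$-quasigeodesic. A hierarchical space $(\mathcal X,\mathfrak S)$ consists of a $q$-quasigeodesic space $(\mathcal X,d_{\mathcal X})$, an index set $\mathfrak S$ and geodesic metric spaces $(\mathcal CW,d_W)$, $W\in\mathfrak S$ (not required to be hyperbolic), such that (1)–(9) below hold. Conventions: the distance between two sets is the infimum of distances between their points; for $x,y\in\mathcal X$ and $p\subseteq\mathcal CW$, $d_W(x,y)=d_W(\pi_W(x),\pi_W(y))$ and $d_W(x,p)=d_W(\pi_W(x),p)$; $V\sqsubset W$ means $V\sqsubseteq W$ and $V\ne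 W$. (1) Projections: there are $\xi,K\ge 0$ and maps $\pi_W:\mathcal X\to2^{\mathcal CW}$ ($W\in\mathfrak S$) sending points to nonempty sets of diameter $\le\xi$; each $\pi_W$ is $(K,K)$-coarsely Lipschitz and $\pi_W(\mathcal X)$ is $K$-quasiconvex in $\mathcal CW$. (2) Nesting: $\mathfrak S$ has a partial order $\sqsubseteq$, and either $\mathfrak S=\emptyset$ or there is a unique $\sqsubseteq$-maximal element. Put $\mathfrak S_W=\{V:V\sqsubseteq W\}$. If $V\sqsubset W$ there is a specified subset $\rho^V_W\subset\mathcal CW$ of diameter $\le\xi$ and a map $\rho^W_V:\mathcal CW\to2^{\mathcal CV}$. (3) Orthogonality: $\mathfrak S$ has a symmetric anti-reflexive relation $\perp$. If $V\sqsubseteq W$ and $W\perp U$ then $V\perp U$. For each $T\in\mathfrak S$ and $U\in\mathfrak S_T$ with $\{V\in\mathfrak S_T:V\perp U\}\ne\emptyset$ there is $W\in\mathfrak S_T-\{T\}$ such that $V\sqsubseteq W$ whenever $V\perp U$ and $V\sqsubseteq T$. If $V\perp W$ then $V,W$ are not $\sqsubseteq$-comparable. (4) Transversality and consistency: if $V,W$ are not orthogonal and neither is nested in the other they are transverse, $V\pitchfork W$. There is $\kappa_0\ge0$ such that: if $V\pitchfork W$ there are sets $\rho^V_W\subseteq\mathcal CW$, $\rho^W_V\subseteq\mathcal CV$ of diameter $\le\xi$ with $\min\{d_W(\pi_W(x),\rho^V_W),d_V(\pi_V(x),\rho^W_V)\}\le\kappa_0$ for all $x\in\mathcal X$; if $V\sqsubset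 W$ then $\min\{d_W(\pi_W(x),\rho^V_W),\mathrm{diam}_{\mathcal CV}(\pi_V(x)\cup\rho^W_V(\pi_W(x)))\}\le\kappa_0$ for all $x$; and if $U\sqsubseteq V$ then $d_W(\rho^U_W,\rho^V_W)\le\kappa_0$ whenever $V\sqsubset W$, or $V\pitchfork W$ and $W\not\perp U$. (5) Finite complexity: there is $n\ge0$ (the complexity) such that any set of pairwise $\sqsubseteq$-comparable elements has at most $n$ elements. (6) Large links: there are $\lambda\ge1$, $E\ge\max\{\xi,\kappa_0\}$ such that for $W\in\mathfrak S$, $x,x'\in\mathcal X$ and $N=\lambda d_W(x,x')+\lambda$ there is a collection $\{T_i\}\subseteq\mathfrak S_W-\{W\}$ of at most $\lfloor N\rfloor$ elements such that every $T\in\mathfrak S_W-\{W\}$ either lies in some $\mathfrak S_{T_i}$ or satisfies $d_T(x,x')<E$; moreover $d_W(x,\rho^{T_i}_W)\le N$ for all $i$. (7) Bounded geodesic image: there is $E>0$ such that for all $V\sqsubset W$ and all geodesics $\gamma$ of $\mathcal CW$, either $\mathrm{diam}_{\mathcal CV}(\rho^W_V(\gamma))\le E$ or $\gamma$ meets the $E$-neighborhood of $\rho^V_W$. (8) Partial realization: there is $\alpha$ such that for every family $\{V_j\}$ of pairwise orthogonal elements and $p_j\in\pi_{V_j}(\mathcal X)$ there is $x\in\mathcal X$ with $d_{V_j}(x,p_j)\le\alpha$ for all $j$, and $d_V(x,\rho^{V_j}_V)\le\alpha$ whenever $V_j\sqsubset V$ or $V\pitchfork V_j$ for some $j$. (9)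 Uniqueness: for each $\kappa\ge0$ there is $\theta_u(\kappa)$ such that $d_{\mathcal X}(x,y)\ge\theta_u(\kappa)$ implies $d_V(x,y)\ge\kappa$ for some $V\in\mathfrak S$. A hierarchical space $(\mathcal X,\mathfrak S)$ is relatively hierarchically hyperbolic if there exists $\delta$ such that for all $U\in\mathfrak S$, either $U$ is $\sqsubseteq$-minimal or $\mathcal CU$ is $\delta$-hyperbolic; and if $U$ is $\sqsubseteq$-minimal and $\mathcal CU$ is not ($\delta$-)hyperbolic, then $\pi_U$ is $E$-coarsely surjective, for a uniform constant $E$. *)

theory Defs
  imports "HOL-Analysis.Analysis"
begin

text \<open>
  Metric spaces are elements of the library type \<^typ>\<open>'a metric\<close>. A coarse map
  into \<open>m\<close> is a set-valued map whose values are nonempty and uniformly bounded.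
\<close>

text \<open>The distance between two sets is the infimum of the distances of their points. It is
  only ever used for nonempty sets.\<close>

definition set_dist :: "'a metric \<Rightarrow> 'a set \<Rightarrow> 'a set \<Rightarrow> real" where
  "set_dist m A B = (INF (a, b)\<in>A \<times> B. mdist m a b)"

text \<open>\<open>diam_le m A r\<close> says that the diameter of \<open>A\<close> (a supremum, possibly infinite) is
  at most \<open>r\<close>.\<close>

definition diam_le :: "'a metric \<Rightarrow> 'a set \<Rightarrow> real \<Rightarrow> bool" where
  "diam_le m A r \<longleftrightarrow> (\<forall>a\<in>A. \<forall>b\<in>A. mdist m a b \<le> r)"

definition nbhd :: "'a metric \<Rightarrow> real \<Rightarrow> 'a set \<Rightarrow> 'a set" where
  "nbhd m r A = (\<Union>a\<in>A. mcball_of m a r)"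

definition geodesic_segment :: "'a metric \<Rightarrow> 'a \<Rightarrow> 'a \<Rightarrow> 'a set \<Rightarrow> bool" where
  "geodesic_segment m x y G \<longleftrightarrow>
     (\<exists>(\<gamma> :: real \<Rightarrow> 'a) l. 0 \<le> l \<and> \<gamma> ` {0..l} \<subseteq> mspace m \<and>
        (\<forall>s\<in>{0..l}. \<forall>t\<in>{0..l}. mdist m (\<gamma> s) (\<gamma> t) = \<bar>s - t\<bar>) \<and>
        \<gamma> 0 = x \<and> \<gamma> l = y \<and> G = \<gamma> ` {0..l})"

definition geodesic_metric :: "'a metric \<Rightarrow> bool" where
  "geodesic_metric m \<longleftrightarrow>
     (\<forall>x\<in>mspace m. \<forall>y\<in>mspace m. \<exists>G. geodesic_segment m x y G)"

text \<open>Gromov hyperbolicity of a geodesic space: geodesic triangles are \<open>\<delta>\<close>-slim.\<close>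

definition hyperbolic :: "real \<Rightarrow> 'a metric \<Rightarrow> bool" where
  "hyperbolic \<delta> m \<longleftrightarrow> geodesic_metric m \<and>
     (\<forall>x y z G1 G2 G3. geodesic_segment m x y G1 \<longrightarrow> geodesic_segment m y z G2 \<longrightarrow>
        geodesic_segment m z x G3 \<longrightarrow> G1 \<subseteq> nbhd m \<delta> (G2 \<union> G3))"

definition quasiconvex :: "real \<Rightarrow> 'a metric \<Rightarrow> 'a set \<Rightarrow> bool" where
  "quasiconvex K m Y \<longleftrightarrow>
     (\<forall>x\<in>Y. \<forall>y\<in>Y. \<forall>G. geodesic_segment m x y G \<longrightarrow> G \<subseteq> nbhd m K Y)"

definition coarse_map :: "real \<Rightarrow> 'd set \<Rightarrow> 'a metric \<Rightarrow> ('d \<Rightarrow> 'a set) \<Rightarrow> bool" where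
  "coarse_map B I m f \<longleftrightarrow>
     (\<forall>t\<in>I. f t \<noteq> {} \<and> f t \<subseteq> mspace m \<and> diam_le m (f t) B)"

text \<open>
  A \<open>(D,D)\<close>-quasigeodesic \<open>f : [0,l] \<rightarrow> m\<close>. As usual for quasi-isometry constants,
  \<open>D \<ge> 1\<close>. The constant \<open>D\<close> also bounds the diameters of the values of the coarse map
  \<open>f\<close>, so that the bound is uniform over families of quasigeodesics.
\<close>

definition quasigeodesic :: "real \<Rightarrow> 'a metric \<Rightarrow> real \<Rightarrow> (real \<Rightarrow> 'a set) \<Rightarrow> bool" where
  "quasigeodesic D m l f \<longleftrightarrow> 1 \<le> D \<and> 0 \<le> l \<and> coarse_map D {0..l} m f \<and>
     (\<forall>s\<in>{0..l}. \<forall>t\<in>{0..l}.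
        (1 / D) * \<bar>s - t\<bar> - D \<le> set_dist m (f s) (f t) \<and>
        set_dist m (f s) (f t) \<le> D * \<bar>s - t\<bar> + D)"

definition joins :: "real \<Rightarrow> (real \<Rightarrow> 'a set) \<Rightarrow> 'a \<Rightarrow> 'a \<Rightarrow> bool" where
  "joins l f x y \<longleftrightarrow> x \<in> f 0 \<and> y \<in> f l"

definition unparam_quasigeodesic ::
    "real \<Rightarrow> 'a metric \<Rightarrow> real \<Rightarrow> (real \<Rightarrow> 'a set) \<Rightarrow> bool" where
  "unparam_quasigeodesic D m l f \<longleftrightarrow> coarse_map D {0..l} m f \<and>
     (\<exists>L g. 0 \<le> L \<and> strict_mono_on {0..L} g \<and> g ` {0..L} \<subseteq> {0..l} \<and> g 0 = 0 \<and> g L = l \<and>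
        quasigeodesic D m L (f \<circ> g) \<and>
        (\<forall>j :: nat. real j + 1 \<le> L \<longrightarrow>
           diam_le m (f (g (real j)) \<union> f (g (real j + 1))) D))"

definition quasigeodesic_metric :: "real \<Rightarrow> 'a metric \<Rightarrow> bool" where
  "quasigeodesic_metric q m \<longleftrightarrow>
     (\<forall>x\<in>mspace m. \<forall>y\<in>mspace m. \<exists>l f. quasigeodesic q m l f \<and> joins l f x y)"


text \<open>
  \<open>\<rho> V W\<close> is the subset \<open>\<rho>\<^sup>V\<^sub>W\<close> of \<open>C W\<close>, meaningful when \<open>V\<close> is properly nested in
  \<open>W\<close> or transverse to \<open>W\<close>. \<open>\<sigma> W V\<close> is the map \<open>\<rho>\<^sup>W\<^sub>V\<close> from \<open>C W\<close> to subsets of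
  \<open>C V\<close>, meaningful when \<open>V\<close> is properly nested in \<open>W\<close>. The spaces \<open>C W\<close> share one
  carrier type, but each has its own carrier set and metric.
\<close>

locale hierarchical_data =
  fixes X :: "'x metric"
    and S :: "'s set"
    and nested :: "'s \<Rightarrow> 's \<Rightarrow> bool"  (infix "\<sqsubseteq>" 50)
    and orth :: "'s \<Rightarrow> 's \<Rightarrow> bool"  (infix "\<bottom>" 50)
    and C :: "'s \<Rightarrow> 'c metric"
    and \<pi> :: "'s \<Rightarrow> 'x \<Rightarrow> 'c set"
    and \<rho> :: "'s \<Rightarrow> 's \<Rightarrow> 'c set"
    and \<sigma> :: "'s \<Rightarrow> 's \<Rightarrow> 'c \<Rightarrow> 'c set"
begin

definition pnested :: "'s \<Rightarrow> 's \<Rightarrow> bool"  (infix "\<sqsubset>" 50) where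
  "V \<sqsubset> W \<longleftrightarrow> V \<sqsubseteq> W \<and> V \<noteq> W"

definition transverse :: "'s \<Rightarrow> 's \<Rightarrow> bool" where
  "transverse V W \<longleftrightarrow> \<not> V \<bottom> W \<and> \<not> V \<sqsubseteq> W \<and> \<not> W \<sqsubseteq> V"

definition below :: "'s \<Rightarrow> 's set" where
  "below W = {V \<in> S. V \<sqsubseteq> W}"

definition image_proj :: "'s \<Rightarrow> 'c set" where
  "image_proj W = (\<Union>x\<in>mspace X. \<pi> W x)"

definition dW :: "'s \<Rightarrow> 'x \<Rightarrow> 'x \<Rightarrow> real" where
  "dW W x y = set_dist (C W) (\<pi> W x) (\<pi> W y)"

definition dWset :: "'s \<Rightarrow> 'x \<Rightarrow> 'c set \<Rightarrow> real" where
  "dWset W x p = set_dist (C W) (\<pi> W x) p"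

end

locale hierarchical_space = hierarchical_data +
  fixes \<xi> \<kappa>\<^sub>0 :: real
  assumes quasigeodesic_X: "\<exists>q. quasigeodesic_metric q X"
    and geodesic_C: "\<And>W. W \<in> S \<Longrightarrow> geodesic_metric (C W)"
    and \<xi>_nonneg: "0 \<le> \<xi>"
    and proj_coarse: "\<And>W. W \<in> S \<Longrightarrow> coarse_map \<xi> (mspace X) (C W) (\<pi> W)"
    and projections: "\<exists>K\<ge>0. \<forall>W\<in>S.
          (\<forall>x\<in>mspace X. \<forall>y\<in>mspace X. dW W x y \<le> K * mdist X x y + K) \<and>
          quasiconvex K (C W) (image_proj W)"
    and nested_refl: "reflp_on S (\<sqsubseteq>)"
    and nested_antisym: "antisymp_on S (\<sqsubseteq>)"
    and nested_trans: "transp_on S (\<sqsubseteq>)"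
    and nested_max: "S = {} \<or> (\<exists>!M. M \<in> S \<and> (\<forall>W\<in>S. M \<sqsubseteq> W \<longrightarrow> W = M))"
    and nested_\<rho>: "\<And>V W. V \<in> S \<Longrightarrow> W \<in> S \<Longrightarrow> V \<sqsubset> W \<Longrightarrow>
          \<rho> V W \<noteq> {} \<and> \<rho> V W \<subseteq> mspace (C W) \<and> diam_le (C W) (\<rho> V W) \<xi>"
    and nested_\<sigma>: "\<And>V W p. V \<in> S \<Longrightarrow> W \<in> S \<Longrightarrow> V \<sqsubset> W \<Longrightarrow> p \<in> mspace (C W) \<Longrightarrow>
          \<sigma> W V p \<noteq> {} \<and> \<sigma> W V p \<subseteq> mspace (C V)"
    and orth_sym: "symp_on S (\<bottom>)"
    and orth_irrefl: "irreflp_on S (\<bottom>)"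
    and orth_nested: "\<And>U V W. U \<in> S \<Longrightarrow> V \<in> S \<Longrightarrow> W \<in> S \<Longrightarrow>
          V \<sqsubseteq> W \<Longrightarrow> W \<bottom> U \<Longrightarrow> V \<bottom> U"
    and orth_container: "\<And>T U. T \<in> S \<Longrightarrow> U \<in> below T \<Longrightarrow> {V \<in> below T. V \<bottom> U} \<noteq> {} \<Longrightarrow>
          \<exists>W \<in> below T - {T}. \<forall>V\<in>S. V \<bottom> U \<longrightarrow> V \<sqsubseteq> T \<longrightarrow> V \<sqsubseteq> W"
    and orth_incomparable: "\<And>V W. V \<in> S \<Longrightarrow> W \<in> S \<Longrightarrow> V \<bottom> W \<Longrightarrow> \<not> V \<sqsubseteq> W \<and> \<not> W \<sqsubseteq> V"
    and \<kappa>\<^sub>0_nonneg: "0 \<le> \<kappa>\<^sub>0"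
    and transverse_\<rho>: "\<And>V W. V \<in> S \<Longrightarrow> W \<in> S \<Longrightarrow> transverse V W \<Longrightarrow>
          \<rho> V W \<noteq> {} \<and> \<rho> V W \<subseteq> mspace (C W) \<and> diam_le (C W) (\<rho> V W) \<xi>"
    and consistency_transverse: "\<And>V W x. V \<in> S \<Longrightarrow> W \<in> S \<Longrightarrow> transverse V W \<Longrightarrow>
          x \<in> mspace X \<Longrightarrow> min (dWset W x (\<rho> V W)) (dWset V x (\<rho> W V)) \<le> \<kappa>\<^sub>0"
    and consistency_nested: "\<And>V W x. V \<in> S \<Longrightarrow> W \<in> S \<Longrightarrow> V \<sqsubset> W \<Longrightarrow> x \<in> mspace X \<Longrightarrow>
          dWset W x (\<rho> V W) \<le> \<kappa>\<^sub>0 \<or> diam_le (C V) (\<pi> V x \<union> (\<Union>p\<in>\<pi> W x. \<sigma> W V p)) \<kappa>\<^sub>0"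
    and consistency_\<rho>: "\<And>U V W. U \<in> S \<Longrightarrow> V \<in> S \<Longrightarrow> W \<in> S \<Longrightarrow> U \<sqsubseteq> V \<Longrightarrow>
          V \<sqsubset> W \<or> (transverse V W \<and> \<not> W \<bottom> U) \<Longrightarrow>
          set_dist (C W) (\<rho> U W) (\<rho> V W) \<le> \<kappa>\<^sub>0"
    and finite_complexity: "\<exists>n::nat. \<forall>A\<subseteq>S. (\<forall>V\<in>A. \<forall>W\<in>A. V \<sqsubseteq> W \<or> W \<sqsubseteq> V) \<longrightarrow>
          finite A \<and> card A \<le> n"
    and large_links: "\<exists>\<Lambda>\<ge>1. \<exists>E\<ge>max \<xi> \<kappa>\<^sub>0. \<forall>W\<in>S. \<forall>x\<in>mspace X. \<forall>x'\<in>mspace X.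
          (let N = \<Lambda> * dW W x x' + \<Lambda> in
             \<exists>\<T>\<subseteq>below W - {W}. finite \<T> \<and> int (card \<T>) \<le> \<lfloor>N\<rfloor> \<and>
               (\<forall>T\<in>below W - {W}. (\<exists>T'\<in>\<T>. T \<in> below T') \<or> dW T x x' < E) \<and>
               (\<forall>T'\<in>\<T>. dWset W x (\<rho> T' W) \<le> N))"
    and bounded_geodesic_image: "\<exists>E>0. \<forall>V\<in>S. \<forall>W\<in>S. V \<sqsubset> W \<longrightarrow>
          (\<forall>a b G. geodesic_segment (C W) a b G \<longrightarrow>
             diam_le (C V) (\<Union>p\<in>G. \<sigma> W V p) E \<or> G \<inter> nbhd (C W) E (\<rho> V W) \<noteq> {})"
    \<comment> \<open>partial realization; a family of pairwise orthogonal elements is injective, hence a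
        set \<open>F\<close>\<close>
    and partial_realization: "\<exists>\<alpha>::real. \<forall>F\<subseteq>S. \<forall>p. pairwise (\<bottom>) F \<longrightarrow>
          (\<forall>V\<in>F. p V \<in> image_proj V) \<longrightarrow>
          (\<exists>x\<in>mspace X. (\<forall>V\<in>F. dWset V x {p V} \<le> \<alpha>) \<and>
             (\<forall>V\<in>F. \<forall>W\<in>S. V \<sqsubset> W \<or> transverse W V \<longrightarrow> dWset W x (\<rho> V W) \<le> \<alpha>))"
    and uniqueness: "\<And>\<kappa>::real. 0 \<le> \<kappa> \<Longrightarrow> \<exists>\<theta>::real. \<forall>x\<in>mspace X. \<forall>y\<in>mspace X.
          \<theta> \<le> mdist X x y \<longrightarrow> (\<exists>V\<in>S. \<kappa> \<le> dW V x y)"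

context hierarchical_data
begin

definition minimal :: "'s \<Rightarrow> bool" where
  "minimal U \<longleftrightarrow> (\<forall>V\<in>S. V \<sqsubseteq> U \<longrightarrow> V = U)"

definition relatively_hierarchically_hyperbolic :: bool where
  "relatively_hierarchically_hyperbolic \<longleftrightarrow>
     (\<exists>\<xi> \<kappa>\<^sub>0. hierarchical_space X S (\<sqsubseteq>) (\<bottom>) C \<pi> \<rho> \<sigma> \<xi> \<kappa>\<^sub>0) \<and>
     (\<exists>\<delta> E. \<forall>U\<in>S. (minimal U \<or> hyperbolic \<delta> (C U)) \<and>
        (minimal U \<and> \<not> hyperbolic \<delta> (C U) \<longrightarrow>
           mspace (C U) \<subseteq> nbhd (C U) E (image_proj U)))"

end

end

theory Submission
  imports Defs
begin

text \<open>
  Points of \<open>X\<close> whose coordinates all lie near geodesics from \<open>\<pi>\<^sub>U x\<close> to \<open>\<pi>\<^sub>U y\<close> form a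
  hull of \<open>x\<close> and \<open>y\<close>. A point \<open>p\<close> is sent into the hull by retracting each of its coordinates
  to the geodesic and realising the resulting tuple; the tuple is consistent because two of the
  three coordinates of \<open>x\<close>, \<open>y\<close>, \<open>p\<close> always agree coarsely where this matters. By uniqueness the
  retraction of \<open>X\<close> to the hull is coarsely Lipschitz, so the hull contains discrete paths of
  length linear in the distance of their endpoints, and a shortest discrete path in the hull from
  \<open>x\<close> to \<open>y\<close> is a quasigeodesic. Its projections stay near geodesics, and the times of last exit
  from initial segments of the geodesic show that they are unparameterized quasigeodesics.

  A consistent tuple is realised by partial realization points of pairwise orthogonal families
  \<open>G\<close>. As long as such a point has a coordinate far from the tuple, the family can be refined,
  and finite complexity bounds the number of refinements.
\<close>

subsection \<open>Geodesic pseudometrics and rails\<close>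

text \<open>A nest-minimal \<open>C U\<close> may fail to be hyperbolic, and closest points to the
  interval between two of its points need not be coarsely unique. So little is asked of the
  retraction in general: to be coarsely Lipschitz, to land between the endpoints and to fix them
  coarsely. This already settles transverse pairs, because a point near two of the coordinates of
  \<open>x\<close>, \<open>y\<close>, \<open>p\<close> is then near the retract of \<open>p\<close>
  as well. The closest point property enters only for \<open>V \<sqsubset> W\<close>, and only in
  \<open>C W\<close>, where \<open>W\<close> is not minimal and hence hyperbolic.

  A retracted coordinate need not be the coordinate of a point. It lies between coordinates of
  \<open>x\<close> and \<open>y\<close>, so quasiconvexity of the image of the projection supplies
  such a point nearby.

  Rails are coarsely one-dimensional: the distance from the start determines a point up to bounded
  error, in minimal domains because \<open>Q\<close> is a single geodesic there. A projected path
  may backtrack, but it is governed by one real function, and this function can be sampled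
  monotonically.\<close>

definition btw :: "('c \<Rightarrow> 'c \<Rightarrow> real) \<Rightarrow> 'c \<Rightarrow> 'c \<Rightarrow> 'c \<Rightarrow> bool" where
  "btw d a m b \<longleftrightarrow> d a m + d m b = d a b"

text \<open>Slim triangles with each side replaced by the metric interval of its ends. In a geodesic
  space that interval is the union of all geodesics between them, by
  \<open>geodesic_through\<close>.\<close>

definition slim :: "('c \<Rightarrow> 'c \<Rightarrow> real) \<Rightarrow> real \<Rightarrow> bool" where
  "slim d k \<longleftrightarrow> (\<forall>a m b z. btw d a m b \<longrightarrow> (\<exists>w. (btw d a w z \<or> btw d b w z) \<and> d m w \<le> k))"

text \<open>
  A rail replaces a geodesic from \<open>a\<close> to \<open>b\<close> and carries a coarsely Lipschitz retraction \<open>f\<close>. In a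
  slim space \<open>Q\<close> is the whole interval between \<open>a\<close> and \<open>b\<close> and \<open>f\<close> is nearly a closest point
  projection. In general \<open>Q\<close> is one geodesic and \<open>f p\<close> is its point at distance
  \<open>min (d a p) (d a b)\<close> from \<open>a\<close>.
\<close>

definition rail :: "('c \<Rightarrow> 'c \<Rightarrow> real) \<Rightarrow> real \<Rightarrow> 'c \<Rightarrow> 'c \<Rightarrow> 'c set \<Rightarrow> ('c \<Rightarrow> 'c) \<Rightarrow> bool" where
  "rail d c a b Q f \<longleftrightarrow> (\<forall>p. f p \<in> Q) \<and> (\<forall>w\<in>Q. btw d a w b \<and> d w (f w) \<le> c) \<and>
     d a (f a) \<le> c \<and> d b (f b) \<le> c \<and> (\<forall>p q. d (f p) (f q) \<le> 3 * d p q + c) \<and>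
     (\<forall>v\<in>Q. \<forall>w\<in>Q. d v w \<le> \<bar>d a v - d a w\<bar> + c)"

text \<open>Distances become pseudometrics once values outside a carrier are identified with points
  inside it. For this reason a geodesic reaches its ends only up to distance zero.\<close>

locale geodesic_pseudometric =
  fixes d :: "'c \<Rightarrow> 'c \<Rightarrow> real"
  assumes refl [simp]: "d a a = 0"
    and sym: "d a b = d b a"
    and tri: "d a c \<le> d a b + d b c"
    and geo: "\<exists>\<gamma>. d (\<gamma> 0) a = 0 \<and> d (\<gamma> (d a b)) b = 0 \<and>
          (\<forall>s\<in>{0..d a b}. \<forall>t\<in>{0..d a b}. d (\<gamma> s) (\<gamma> t) = \<bar>s - t\<bar>)"
begin

lemma nonneg [simp]: "0 \<le> d a b"
  using tri[of a a b] sym[of a b] by simp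

lemma midpoint: "\<exists>m. d a m = d a b / 2 \<and> d m b = d a b / 2"
proof -
  obtain \<gamma> where g: "d (\<gamma> 0) a = 0" "d (\<gamma> (d a b)) b = 0"
      "\<forall>s\<in>{0..d a b}. \<forall>t\<in>{0..d a b}. d (\<gamma> s) (\<gamma> t) = \<bar>s - t\<bar>"
    using geo by blast
  let ?m = "\<gamma> (d a b / 2)"
  have "d (\<gamma> 0) ?m = d a b / 2" "d ?m (\<gamma> (d a b)) = d a b / 2"
    using g(3) by auto
  then have "d a ?m \<le> d a b / 2" "d ?m b \<le> d a b / 2"
    using tri[of a ?m "\<gamma> 0"] tri[of ?m b "\<gamma> (d a b)"] g sym[of a "\<gamma> 0"] by auto
  with tri[of a b ?m] have "d a ?m = d a b / 2 \<and> d ?m b = d a b / 2" by linarith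
  then show ?thesis ..
qed

lemma btw_trans: "btw d a m b \<Longrightarrow> btw d a w m \<Longrightarrow> btw d a w b"
  unfolding btw_def using tri[of a b w] tri[of w b m] by linarith

lemma btw_sym: "btw d a m b \<longleftrightarrow> btw d b m a"
  unfolding btw_def using sym[of a m] sym[of m b] sym[of a b] by linarith

lemma rail_segment:
  assumes "0 \<le> c"
  shows "\<exists>Q f. rail d c a b Q f"
proof -
  obtain \<gamma> where g: "d (\<gamma> 0) a = 0" "d (\<gamma> (d a b)) b = 0"
      and iso: "\<And>s t. s \<in> {0..d a b} \<Longrightarrow> t \<in> {0..d a b} \<Longrightarrow> d (\<gamma> s) (\<gamma> t) = \<bar>s - t\<bar>"
    using geo by blast
  define h where "h p = min (d a p) (d a b)" for p
  have h: "h p \<in> {0..d a b}" for p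
    by (simp add: h_def)
  have da: "d a (\<gamma> t) = t" and db: "d (\<gamma> t) b = d a b - t" if "t \<in> {0..d a b}" for t
    using iso[of 0 t] iso[of t "d a b"] that tri[of a "\<gamma> t" "\<gamma> 0"] tri[of "\<gamma> 0" "\<gamma> t" a]
      tri[of "\<gamma> t" b "\<gamma> (d a b)"] tri[of "\<gamma> t" "\<gamma> (d a b)" b] g sym[of a "\<gamma> 0"] sym[of b "\<gamma> (d a b)"]
    by auto
  have hh: "\<bar>h p - h q\<bar> \<le> d p q" for p q
    using tri[of a p q] tri[of a q p] sym[of p q] unfolding h_def by auto
  have hg: "h (\<gamma> t) = t" if "t \<in> {0..d a b}" for t
    using da[OF that] that by (simp add: h_def)
  have "h a = 0" "h b = d a b"
    by (auto simp: h_def)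
  then have "rail d c a b (\<gamma> ` {0..d a b}) (\<lambda>p. \<gamma> (h p))"
    unfolding rail_def
    using h hg da db g assms sym[of a "\<gamma> 0"] sym[of b "\<gamma> (d a b)"] iso[OF h h]
      order_trans[OF hh] 
    by (auto simp: btw_def iso)
  then show ?thesis by blast
qed

text \<open>The midpoint \<open>m\<close> of \<open>f p\<close> and \<open>f q\<close> is within
  \<open>k\<close> of the interval from \<open>a\<close> to \<open>b\<close>, so \<open>f p\<close>
  is almost as close to \<open>p\<close> as \<open>m\<close> is, and likewise for \<open>q\<close>.
  Slimness of the quadrilateral \<open>f p\<close>, \<open>p\<close>, \<open>q\<close>,
  \<open>f q\<close> gives a point near \<open>m\<close> on another side. On a leg, it forces
  \<open>m\<close> to be near \<open>f p\<close> or \<open>f q\<close>; on the side from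
  \<open>p\<close> to \<open>q\<close>, it bounds the sum of the legs by about \<open>d p q\<close>.
  The leg reached after two triangles yields \<open>10 * k + 2\<close>.\<close>

lemma rail_slim:
  assumes k: "0 \<le> k" and slim: "slim d k"
  shows "\<exists>f. rail d (10 * k + 2) a b {w. btw d a w b} f \<and>
           (\<forall>p w. btw d a w b \<longrightarrow> d p (f p) \<le> d p w + 1)"
proof -
  let ?I = "{w. btw d a w b}"
  have ab: "a \<in> ?I" "b \<in> ?I"
    by (auto simp: btw_def)
  have "\<exists>v\<in>?I. \<forall>w\<in>?I. d p v \<le> d p w + 1" for p
  proof -
    have bdd: "bdd_below (d p ` ?I)"
      by (intro bdd_belowI[of _ 0]) auto
    \<comment> \<open>The infimum need not be attained; this is the origin of the error 1.\<close>
    obtain v where "v \<in> ?I" "d p v < Inf (d p ` ?I) + 1"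
      using cInf_lessD[of "d p ` ?I" "Inf (d p ` ?I) + 1"] ab by auto
    moreover have "Inf (d p ` ?I) \<le> d p w" if "w \<in> ?I" for w
      using cInf_lower[OF _ bdd] that by blast
    ultimately show ?thesis by force
  qed
  then obtain f where fI: "\<And>p. f p \<in> ?I" and f: "\<And>p w. w \<in> ?I \<Longrightarrow> d p (f p) \<le> d p w + 1"
    by metis
  have lip: "d (f p) (f q) \<le> 3 * d p q + (10 * k + 2)" for p q
  proof -
    let ?l = "d (f p) (f q)"
    obtain m where m: "d (f p) m = ?l / 2" "d m (f q) = ?l / 2"
      using midpoint by blast
    then have mb: "btw d (f p) m (f q)" by (simp add: btw_def)
    obtain v where v: "btw d (f p) v a \<or> btw d (f q) v a" "d m v \<le> k"
      using slim mb unfolding slim_def by blast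
    have "v \<in> ?I"
      using v(1) btw_trans[of a "f p" b v] btw_trans[of a "f q" b v] fI[of p] fI[of q] btw_sym by auto
    then have mp: "d p (f p) \<le> d p m + k + 1" and mq: "d q (f q) \<le> d q m + k + 1"
      using f[of v p] f[of v q] v(2) tri[of p v m] tri[of q v m] by auto
    obtain w where w: "btw d (f p) w q \<or> btw d (f q) w q" "d m w \<le> k"
      using slim mb unfolding slim_def by blast
    show ?thesis
      using w(1)
    proof
      assume "btw d (f q) w q"
      then have "d w (f q) \<le> 2 * k + 1"
        using mq tri[of q m w] w(2) sym[of m w] sym[of q w] sym[of w "f q"] sym[of q "f q"]
        unfolding btw_def by linarith
      then show ?thesis
        using m tri[of m "f q" w] w(2) k nonneg[of p q] by linarith
    next
      assume "btw d (f p) w q"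
      then obtain w' where w': "btw d (f p) w' p \<or> btw d q w' p" "d w w' \<le> k"
        using slim unfolding slim_def by blast
      then have mw': "d m w' \<le> 2 * k" using tri[of m w' w] w(2) by linarith
      show ?thesis
        using w'(1)
      proof
        assume "btw d (f p) w' p"
        then have "d w' (f p) \<le> 3 * k + 1"
          using mp tri[of p m w'] mw' sym[of m w'] sym[of p w'] sym[of w' "f p"] sym[of p "f p"]
          unfolding btw_def by linarith
        then show ?thesis
          using m tri[of m "f p" w'] mw' k nonneg[of p q] sym[of m "f p"] by linarith
      next
        assume "btw d q w' p"
        then have "d p m + d q m \<le> d p q + 4 * k"
          using tri[of p m w'] tri[of q m w'] mw' sym[of m w'] sym[of p w'] sym[of p q]
          unfolding btw_def by linarith
        then show ?thesis
          using mp mq tri[of "f p" "f q" p] tri[of p "f q" q] sym[of p "f p"] k nonneg[of p q]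
          by linarith
      qed
    qed
  qed
  \<comment> \<open>A point \<open>u\<close> near \<open>v\<close> on the side from \<open>a\<close>
    to \<open>w\<close> has distance about \<open>d a w - d a v\<close> from \<open>w\<close>. On
    the side from \<open>b\<close> its distance from \<open>w\<close> is at most \<open>k\<close>,
    since \<open>w\<close> is no farther from \<open>b\<close> than \<open>v\<close>.\<close>
  have thin: "d v w \<le> d a w - d a v + 2 * k" if I: "v \<in> ?I" "w \<in> ?I" and le: "d a v \<le> d a w" for v w
  proof -
    obtain u where u: "btw d a u w \<or> btw d b u w" "d v u \<le> k"
      using slim I(1) unfolding slim_def by blast
    show ?thesis
      using u I le tri[of v w u] tri[of a v u] tri[of b v u] sym[of v u] sym[of v b] sym[of w b] sym[of b u]
      unfolding btw_def by auto
  qed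
  have "d v w \<le> \<bar>d a v - d a w\<bar> + (10 * k + 2)" if "v \<in> ?I" "w \<in> ?I" for v w
    using thin[OF that] thin[OF that(2,1)] sym[of v w] k by (cases "d a v \<le> d a w") auto
  moreover have "d w (f w) \<le> 10 * k + 2" if "w \<in> ?I" for w
    using f[OF that, of w] k by simp
  ultimately have "rail d (10 * k + 2) a b ?I f"
    using fI lip ab unfolding rail_def by auto
  then show ?thesis using f by auto
qed

end

subsection \<open>Coarse hierarchies\<close>

text \<open>
  Here \<open>e W x\<close>, \<open>r V W\<close> and \<open>s W V\<close> are points chosen in \<open>\<pi>\<^sub>W(x)\<close> and \<open>\<rho>\<^sup>V\<^sub>W\<close> and a pointwise choice in
  the map \<open>\<rho>\<^sup>W\<^sub>V\<close>, all distances are defined on whole types, and one constant \<open>k\<close> serves for all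
  axioms. The bounded rank \<open>rk\<close> encodes finite complexity.
\<close>

locale coarse_hierarchy =
  fixes S :: "'s set"
    and nested :: "'s \<Rightarrow> 's \<Rightarrow> bool"  (infix "\<sqsubseteq>" 50)
    and orth :: "'s \<Rightarrow> 's \<Rightarrow> bool"  (infix "\<bottom>" 50)
    and dX :: "'x \<Rightarrow> 'x \<Rightarrow> real"
    and d :: "'s \<Rightarrow> 'c \<Rightarrow> 'c \<Rightarrow> real"
    and e :: "'s \<Rightarrow> 'x \<Rightarrow> 'c"
    and r :: "'s \<Rightarrow> 's \<Rightarrow> 'c"
    and s :: "'s \<Rightarrow> 's \<Rightarrow> 'c \<Rightarrow> 'c"
    and k :: real
    and rk :: "'s \<Rightarrow> nat"
    and n :: nat
  assumes pm: "\<And>W. geodesic_pseudometric (d W)"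
    and k: "1 \<le> k"
    and nested_refl: "\<And>V. V \<in> S \<Longrightarrow> V \<sqsubseteq> V"
    and nested_trans: "\<And>U V W. U \<in> S \<Longrightarrow> V \<in> S \<Longrightarrow> W \<in> S \<Longrightarrow> U \<sqsubseteq> V \<Longrightarrow> V \<sqsubseteq> W \<Longrightarrow> U \<sqsubseteq> W"
    and nested_antisym: "\<And>V W. V \<in> S \<Longrightarrow> W \<in> S \<Longrightarrow> V \<sqsubseteq> W \<Longrightarrow> W \<sqsubseteq> V \<Longrightarrow> V = W"
    and top: "S = {} \<or> (\<exists>M\<in>S. \<forall>V\<in>S. V \<sqsubseteq> M)"
    and orth_sym: "\<And>V W. V \<in> S \<Longrightarrow> W \<in> S \<Longrightarrow> V \<bottom> W \<Longrightarrow> W \<bottom> V"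
    and orth_nested: "\<And>U V W. U \<in> S \<Longrightarrow> V \<in> S \<Longrightarrow> W \<in> S \<Longrightarrow> V \<sqsubseteq> W \<Longrightarrow> W \<bottom> U \<Longrightarrow> V \<bottom> U"
    and orth_container: "\<And>T U V. T \<in> S \<Longrightarrow> U \<in> S \<Longrightarrow> V \<in> S \<Longrightarrow> U \<sqsubseteq> T \<Longrightarrow> V \<sqsubseteq> T \<Longrightarrow> V \<bottom> U \<Longrightarrow>
          \<exists>W\<in>S. W \<sqsubseteq> T \<and> W \<noteq> T \<and> (\<forall>V\<in>S. V \<bottom> U \<longrightarrow> V \<sqsubseteq> T \<longrightarrow> V \<sqsubseteq> W)"
    and orth_incomparable: "\<And>V W. V \<in> S \<Longrightarrow> W \<in> S \<Longrightarrow> V \<bottom> W \<Longrightarrow> \<not> V \<sqsubseteq> W \<and> \<not> W \<sqsubseteq> V"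
    and rk_less: "\<And>V W. V \<in> S \<Longrightarrow> W \<in> S \<Longrightarrow> V \<sqsubseteq> W \<Longrightarrow> V \<noteq> W \<Longrightarrow> rk V < rk W"
    and rk_le: "\<And>V. V \<in> S \<Longrightarrow> rk V \<le> n"
    and transverse_consistent: "\<And>V W x. V \<in> S \<Longrightarrow> W \<in> S \<Longrightarrow>
          \<not> V \<bottom> W \<Longrightarrow> \<not> V \<sqsubseteq> W \<Longrightarrow> \<not> W \<sqsubseteq> V \<Longrightarrow>
          d W (e W x) (r V W) \<le> k \<or> d V (e V x) (r W V) \<le> k"
    and nested_consistent: "\<And>V W x. V \<in> S \<Longrightarrow> W \<in> S \<Longrightarrow> V \<sqsubseteq> W \<Longrightarrow> V \<noteq> W \<Longrightarrow>
          d W (e W x) (r V W) \<le> k \<or> d V (e V x) (s W V (e W x)) \<le> k"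
    and rho_consistent: "\<And>U V W. U \<in> S \<Longrightarrow> V \<in> S \<Longrightarrow> W \<in> S \<Longrightarrow> U \<sqsubseteq> V \<Longrightarrow>
          (V \<sqsubseteq> W \<and> V \<noteq> W) \<or> (\<not> V \<bottom> W \<and> \<not> V \<sqsubseteq> W \<and> \<not> W \<sqsubseteq> V \<and> \<not> W \<bottom> U) \<Longrightarrow>
          d W (r U W) (r V W) \<le> k"
    and large_links: "\<And>W x x'. W \<in> S \<Longrightarrow> \<exists>\<T>. finite \<T> \<and> \<T> \<subseteq> {T\<in>S. T \<sqsubseteq> W \<and> T \<noteq> W} \<and>
          real (card \<T>) \<le> k * d W (e W x) (e W x') + k \<and>
          (\<forall>T\<in>S. T \<sqsubseteq> W \<longrightarrow> T \<noteq> W \<longrightarrow> (\<exists>T'\<in>\<T>. T \<sqsubseteq> T') \<or> d T (e T x) (e T x') \<le> k)"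
    and bounded_image: "\<And>V W a b. V \<in> S \<Longrightarrow> W \<in> S \<Longrightarrow> V \<sqsubseteq> W \<Longrightarrow> V \<noteq> W \<Longrightarrow>
          d V (s W V a) (s W V b) \<le> k \<or> (\<exists>z. btw (d W) a z b \<and> d W z (r V W) \<le> k)"
    and partial_realization: "\<And>F z. F \<subseteq> S \<Longrightarrow> pairwise (\<bottom>) F \<Longrightarrow>
          \<exists>x. (\<forall>V\<in>F. d V (e V x) (e V (z V)) \<le> k) \<and>
            (\<forall>V\<in>F. \<forall>W\<in>S. (V \<sqsubseteq> W \<and> V \<noteq> W) \<or> (\<not> V \<bottom> W \<and> \<not> V \<sqsubseteq> W \<and> \<not> W \<sqsubseteq> V) \<longrightarrow>
               d W (e W x) (r V W) \<le> k)"
    and dX_refl [simp]: "\<And>x. dX x x = 0"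
    and dX_sym: "\<And>x y. dX x y = dX y x"
    and dX_tri: "\<And>x y z. dX x z \<le> dX x y + dX y z"
    and lipschitz: "\<And>W x y. W \<in> S \<Longrightarrow> d W (e W x) (e W y) \<le> k * dX x y + k"
    and quasiconvex: "\<And>W x y m. W \<in> S \<Longrightarrow> btw (d W) (e W x) m (e W y) \<Longrightarrow> \<exists>z. d W (e W z) m \<le> k"
    and hyperbolic: "\<And>V W. V \<in> S \<Longrightarrow> W \<in> S \<Longrightarrow> V \<sqsubseteq> W \<Longrightarrow> V \<noteq> W \<Longrightarrow> slim (d W) k"
    and uniqueness: "\<And>c. \<exists>\<theta>. \<forall>x y. (\<forall>V\<in>S. d V (e V x) (e V y) \<le> c) \<longrightarrow> dX x y \<le> \<theta>"
    and chains: "\<And>x y. \<exists>(m::nat) c. c 0 = x \<and> c m = y \<and> real m \<le> k * dX x y + k \<and>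
          (\<forall>i<m. dX (c i) (c (Suc i)) \<le> k)"
begin

abbreviation pnested :: "'s \<Rightarrow> 's \<Rightarrow> bool"  (infix "\<sqsubset>" 50) where
  "V \<sqsubset> W \<equiv> V \<sqsubseteq> W \<and> V \<noteq> W"

definition transverse :: "'s \<Rightarrow> 's \<Rightarrow> bool"  (infix "\<pitchfork>" 50) where
  "V \<pitchfork> W \<longleftrightarrow> \<not> V \<bottom> W \<and> \<not> V \<sqsubseteq> W \<and> \<not> W \<sqsubseteq> V"

lemmas tri = geodesic_pseudometric.tri[OF pm]
  and sym = geodesic_pseudometric.sym[OF pm]
  and d_refl [simp] = geodesic_pseudometric.refl[OF pm]
  and d_nonneg [simp] = geodesic_pseudometric.nonneg[OF pm]

section \<open>Orthogonal families and domains in which two points differ\<close>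

lemma transverse_sym: "V \<in> S \<Longrightarrow> W \<in> S \<Longrightarrow> V \<pitchfork> W \<Longrightarrow> W \<pitchfork> V"
  unfolding transverse_def using orth_sym by blast

lemma transverse_above:
  assumes "E \<in> S" "T \<in> S" "U \<in> S" "T \<sqsubseteq> U" "E \<pitchfork> T" "\<not> E \<sqsubset> U"
  shows "U = E \<or> E \<pitchfork> U"
  using assms orth_nested[of E T U] orth_sym nested_trans unfolding transverse_def by metis

text \<open>Remove one element: the others are orthogonal to it, so a container of smaller rank
  holds all of them.\<close>

lemma orthogonal_card:
  assumes "T \<in> S" "finite F" "F \<subseteq> {V\<in>S. V \<sqsubseteq> T}" "pairwise (\<bottom>) F"
  shows "card F \<le> rk T + 1"
  using assms
proof (induction "rk T" arbitrary: T F rule: less_induct)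
  case less
  show ?case
  proof (cases "\<exists>U\<in>F. \<exists>V\<in>F. V \<noteq> U")
    case True
    then obtain U V where UV: "U \<in> F" "V \<in> F" "V \<noteq> U" by blast
    then have "V \<bottom> U" using less.prems(4) by (simp add: pairwise_def)
    then obtain W where W: "W \<in> S" "W \<sqsubset> T" "\<forall>V\<in>S. V \<bottom> U \<longrightarrow> V \<sqsubseteq> T \<longrightarrow> V \<sqsubseteq> W"
      using orth_container[of T U V] UV less.prems by blast
    have "card (F - {U}) \<le> rk W + 1"
      using less.prems UV W rk_less[of W T]
      by (intro less.hyps) (auto simp: pairwise_def)
    moreover have "rk W < rk T" using rk_less W less.prems by blast
    ultimately show ?thesis
      using card_Diff_singleton[OF UV(1)] by linarith
  next
    case False
    then have "card F \<le> 1"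
      using less.prems(2) by (metis (no_types, lifting) card_le_Suc0_iff_eq One_nat_def)
    then show ?thesis by simp
  qed
qed

lemma orthogonal_finite:
  assumes F: "F \<subseteq> S" "pairwise (\<bottom>) F"
  shows "finite F" "card F \<le> n + 1"
proof -
  have *: "card G \<le> n + 1" if G: "finite G" "G \<subseteq> F" for G
  proof (cases "G = {}")
    case False
    then obtain M where M: "M \<in> S" "\<forall>V\<in>S. V \<sqsubseteq> M" using top F(1) G(2) by blast
    then have "card G \<le> rk M + 1"
      using G F(1) pairwise_subset[OF F(2)] by (intro orthogonal_card) auto
    then show ?thesis using rk_le[OF M(1)] by linarith
  qed simp
  show fin: "finite F"
  proof (rule ccontr)
    assume "infinite F"
    then obtain G where "G \<subseteq> F" "finite G" "card G = n + 2"
      using infinite_arbitrarily_large by blast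
    then show False using *[of G] by simp
  qed
  show "card F \<le> n + 1" using *[OF fin] by simp
qed

text \<open>An element of \<open>\<E>\<close> strictly below \<open>T\<close> lies below one of the
  large links of \<open>T\<close>, as its coordinates differ by more than \<open>k\<close>. The
  links number at most \<open>N\<close>, because \<open>c\<close> bounds the distance in
  \<open>T\<close> once an element of \<open>\<E>\<close> lies strictly below it. They have smaller
  rank, hence the power of \<open>N + 1\<close>.\<close>

lemma card_relevant:
  assumes N: "k * c + k \<le> real N"
    and \<E>: "finite \<E>" "\<E> \<subseteq> S" "\<And>E. E \<in> \<E> \<Longrightarrow> k < d E (e E x) (e E y)"
    and c: "\<And>E T. E \<in> \<E> \<Longrightarrow> T \<in> S \<Longrightarrow> E \<sqsubset> T \<Longrightarrow> d T (e T x) (e T y) \<le> c"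
  shows "card \<E> \<le> (N + 1) ^ n"
proof -
  have *: "card {E\<in>\<E>. E \<sqsubseteq> T} \<le> (N + 1) ^ rk T" if "T \<in> S" for T
    using that
  proof (induction "rk T" arbitrary: T rule: less_induct)
    case less
    show ?case
    proof (cases "\<exists>E\<in>\<E>. E \<sqsubset> T")
      case True
      then have "d T (e T x) (e T y) \<le> c" using c less.prems by blast
      then have "k * d T (e T x) (e T y) \<le> k * c" using k by (intro mult_left_mono) auto
      then obtain \<T> where \<T>: "finite \<T>" "\<T> \<subseteq> {T'\<in>S. T' \<sqsubset> T}" "real (card \<T>) \<le> real N"
          "\<forall>E\<in>S. E \<sqsubseteq> T \<longrightarrow> E \<noteq> T \<longrightarrow> (\<exists>T'\<in>\<T>. E \<sqsubseteq> T') \<or> d E (e E x) (e E y) \<le> k"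
        using large_links[OF less.prems, of x y] N by fastforce
      have rkT: "0 < rk T"
        using True \<E>(2) rk_less less.prems by (metis gr_zeroI less_zeroE subsetD)
      have "{E\<in>\<E>. E \<sqsubseteq> T} \<subseteq> {T} \<union> (\<Union>T'\<in>\<T>. {E\<in>\<E>. E \<sqsubseteq> T'})"
        using \<T>(4) \<E> by fastforce
      then have "card {E\<in>\<E>. E \<sqsubseteq> T} \<le> card ({T} \<union> (\<Union>T'\<in>\<T>. {E\<in>\<E>. E \<sqsubseteq> T'}))"
        using \<T>(1) \<E>(1) by (intro card_mono) auto
      also have "\<dots> \<le> 1 + card (\<Union>T'\<in>\<T>. {E\<in>\<E>. E \<sqsubseteq> T'})"
        using card_Un_le[of "{T}"] by simp
      also have "\<dots> \<le> 1 + (\<Sum>T'\<in>\<T>. card {E\<in>\<E>. E \<sqsubseteq> T'})"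
        using card_UN_le[OF \<T>(1)] by simp
      also have "(\<Sum>T'\<in>\<T>. card {E\<in>\<E>. E \<sqsubseteq> T'}) \<le> (\<Sum>T'\<in>\<T>. (N + 1) ^ (rk T - 1))"
      proof (rule sum_mono)
        fix T' assume "T' \<in> \<T>"
        then have T': "T' \<in> S" "T' \<sqsubset> T" using \<T>(2) by auto
        then have lt: "rk T' < rk T" using rk_less less.prems by blast
        then have "card {E\<in>\<E>. E \<sqsubseteq> T'} \<le> (N + 1) ^ rk T'" using less.hyps T' by blast
        also have "\<dots> \<le> (N + 1) ^ (rk T - 1)" using lt by (intro power_increasing) auto
        finally show "card {E\<in>\<E>. E \<sqsubseteq> T'} \<le> (N + 1) ^ (rk T - 1)" .
      qed
      also have "\<dots> \<le> N * (N + 1) ^ (rk T - 1)"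
        using \<T>(3) by simp
      also have "1 + \<dots> \<le> (N + 1) * (N + 1) ^ (rk T - 1)" by simp
      also have "\<dots> = (N + 1) ^ rk T" using rkT by (metis power_minus_mult mult.commute)
      finally show ?thesis by simp
    next
      case False
      then have "{E\<in>\<E>. E \<sqsubseteq> T} \<subseteq> {T}" by blast
      then have "card {E\<in>\<E>. E \<sqsubseteq> T} \<le> 1" using card_mono[of "{T}"] by force
      also have "\<dots> \<le> (N + 1) ^ rk T" by simp
      finally show ?thesis .
    qed
  qed
  show ?thesis
  proof (cases "\<E> = {}")
    case False
    then obtain M where M: "M \<in> S" "\<forall>V\<in>S. V \<sqsubseteq> M" using top \<E>(2) by blast
    then have "{E\<in>\<E>. E \<sqsubseteq> M} = \<E>" using \<E>(2) by blast
    then have "card \<E> \<le> (N + 1) ^ rk M" using *[OF M(1)] by simp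
    also have "\<dots> \<le> (N + 1) ^ n" using rk_le[OF M(1)] by (intro power_increasing) auto
    finally show ?thesis .
  qed simp
qed

text \<open>A tuple is given by points \<open>b W\<close> of the space, its \<open>W\<close>-coordinate being \<open>e W (b W)\<close>.\<close>

definition consistent :: "real \<Rightarrow> ('s \<Rightarrow> 'x) \<Rightarrow> bool" where
  "consistent \<kappa> b \<longleftrightarrow> (\<forall>V\<in>S. \<forall>W\<in>S.
     (V \<pitchfork> W \<longrightarrow> d W (e W (b W)) (r V W) \<le> \<kappa> \<or> d V (e V (b V)) (r W V) \<le> \<kappa>) \<and>
     (V \<sqsubset> W \<longrightarrow> d W (e W (b W)) (r V W) \<le> \<kappa> \<or> d V (e V (b V)) (s W V (e W (b W))) \<le> \<kappa>))"

text \<open>Partial realization at \<open>E\<close> gives a point near \<open>r E T\<close> in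
  exactly these \<open>T\<close>; goodness makes the tuple agree with that point there.\<close>

definition good :: "('s \<Rightarrow> 'x) \<Rightarrow> real \<Rightarrow> 's \<Rightarrow> bool" where
  "good b c E \<longleftrightarrow> (\<forall>T\<in>S. E \<sqsubset> T \<or> E \<pitchfork> T \<longrightarrow> d T (e T (b T)) (r E T) \<le> c)"

lemma good_mono: "good b c E \<Longrightarrow> c \<le> c' \<Longrightarrow> good b c' E"
  unfolding good_def by (meson order_trans)

text \<open>If the tuple were far from \<open>r E T\<close> in \<open>T\<close>, so would be
  \<open>p\<close>, and consistency would express both \<open>E\<close>-coordinates through
  \<open>s T E\<close>. These differ, so bounded geodesic image makes the interval between the two
  \<open>T\<close>-coordinates pass near \<open>r E T\<close>, although it has length at most
  \<open>c\<close>.\<close>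

lemma near_rho_above:
  assumes b: "consistent \<kappa> b" "k \<le> \<kappa>" and ET: "E \<in> S" "T \<in> S" "E \<sqsubset> T"
    and far: "\<kappa> + 2 * k < d E (e E p) (e E (b E))" and near: "d T (e T p) (e T (b T)) \<le> c"
  shows "d T (e T (b T)) (r E T) \<le> c + 2 * \<kappa>"
proof (rule ccontr)
  assume not: "\<not> ?thesis"
  have c: "0 \<le> c" using near d_nonneg order_trans by blast
  have 1: "d E (e E (b E)) (s T E (e T (b T))) \<le> \<kappa>"
    using b ET not c k unfolding consistent_def by force
  have 2: "d E (e E p) (s T E (e T p)) \<le> k"
    using nested_consistent[of E T p] ET not near b tri[of T "e T (b T)" "r E T" "e T p"]
      sym[of T "e T (b T)" "e T p"] k by fastforce
  have "\<not> d E (s T E (e T p)) (s T E (e T (b T))) \<le> k"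
    using 1 2 far tri[of E "e E p" "e E (b E)" "s T E (e T p)"]
      tri[of E "s T E (e T p)" "e E (b E)" "s T E (e T (b T))"]
      sym[of E "e E (b E)" "s T E (e T (b T))"] by linarith
  then obtain z where z: "btw (d T) (e T p) z (e T (b T))" "d T z (r E T) \<le> k"
    using bounded_image[of E T "e T p" "e T (b T)"] ET by blast
  have "d T z (e T (b T)) \<le> c"
    using z(1) near d_nonneg[of T "e T p" z] unfolding btw_def by linarith
  then show False
    using z(2) not tri[of T "e T (b T)" "r E T" z] sym[of T z "e T (b T)"] b(2) k by linarith
qed

text \<open>If the tuple were far from \<open>r E T\<close>, consistency would place both
  \<open>E\<close>-coordinates near the same point \<open>r T E\<close>.\<close>

lemma near_rho_transverse:
  assumes b: "consistent \<kappa> b" "k \<le> \<kappa>" and ET: "E \<in> S" "T \<in> S" "E \<pitchfork> T"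
    and far: "\<kappa> + k < d E (e E p) (e E (b E))" and near: "d T (e T p) (e T (b T)) \<le> c"
  shows "d T (e T (b T)) (r E T) \<le> c + 2 * \<kappa>"
proof (rule ccontr)
  assume not: "\<not> ?thesis"
  have c: "0 \<le> c" using near d_nonneg order_trans by blast
  have 1: "d E (e E (b E)) (r T E) \<le> \<kappa>"
    using b ET not c k unfolding consistent_def by force
  have "d E (e E p) (r T E) \<le> k"
    using transverse_consistent[of E T p] ET not near b tri[of T "e T (b T)" "r E T" "e T p"]
      sym[of T "e T (b T)" "e T p"] k unfolding transverse_def by fastforce
  then show False
    using 1 far tri[of E "e E p" "e E (b E)" "r T E"] sym[of E "e E (b E)" "r T E"] by linarith
qed

subsection \<open>Realization of consistent tuples\<close>

text \<open>
  \<open>E\<close> is nest-maximal among the domains where \<open>p\<close> and \<open>b\<close> differ, and last in the usual order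
  of relevant domains between \<open>p\<close> and \<open>b\<close>. Since \<open>b\<close> is not a point, large links do not bound these
  domains directly; but if a chain were infinite, a partial realization point \<open>q\<close> of its \<open>m\<close>-th
  element would be far from \<open>p\<close> in the first \<open>m\<close> elements and uniformly close to \<open>p\<close> in everything
  above them.
\<close>

lemma exists_good:
  assumes b: "consistent \<kappa> b" "k \<le> \<kappa>" and B: "10 * \<kappa> \<le> B"
    and E0: "E0 \<in> S" "B < d E0 (e E0 p) (e E0 (b E0))"
  shows "\<exists>E\<in>S. B < d E (e E p) (e E (b E)) \<and> good b (B + 2 * \<kappa>) E"
proof -
  define \<beta> where "\<beta> V = e V (b V)" for V
  define bad where "bad E \<longleftrightarrow> E \<in> S \<and> B < d E (e E p) (\<beta> E)" for E
  define M where "M = {E. bad E \<and> (\<forall>T. bad T \<longrightarrow> \<not> E \<sqsubset> T)}"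
  \<comment> \<open>On the way from \<open>p\<close> to the tuple, \<open>E\<close> is crossed
    before \<open>T\<close>: by \<open>arrowD\<close>, the tuple has already reached
    \<open>r T E\<close> in \<open>E\<close>, while \<open>p\<close> is still at
    \<open>r E T\<close> in \<open>T\<close>.\<close>
  define arrow where "arrow E T \<longleftrightarrow> E \<in> M \<and> T \<in> M \<and> E \<pitchfork> T \<and> 2 * \<kappa> < d T (\<beta> T) (r E T)" for E T
  note \<kappa> = order_trans[OF k b(2)]
  have M: "E \<in> S" "B < d E (e E p) (\<beta> E)" if "E \<in> M" for E
    using that by (auto simp: M_def bad_def)
  have M_above: "d T (e T p) (\<beta> T) \<le> B" if "E \<in> M" "T \<in> S" "E \<sqsubset> T" for E T
    using that unfolding M_def bad_def by force
  have ex_above: "\<exists>E'\<in>M. E \<sqsubseteq> E'" if "bad E" for E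
    using that
  proof (induction "n - rk E" arbitrary: E rule: less_induct)
    case less
    show ?case
    proof (cases "E \<in> M")
      case False
      then obtain T where T: "bad T" "E \<sqsubset> T" using less.prems unfolding M_def by blast
      moreover have "n - rk T < n - rk E"
        using T less.prems rk_less[of E T] rk_le[of T] unfolding bad_def by force
      ultimately obtain E' where "E' \<in> M" "T \<sqsubseteq> E'" using less.hyps by blast
      then show ?thesis using T less.prems nested_trans M unfolding bad_def by blast
    qed (use less.prems nested_refl bad_def in blast)
  qed
  have arrowD: "d E (\<beta> E) (r T E) \<le> \<kappa>" "d T (e T p) (r E T) \<le> k" if "arrow E T" for E T
  proof -
    have ET: "E \<in> S" "T \<in> S" "E \<pitchfork> T" "B < d E (e E p) (\<beta> E)"
      using that M by (auto simp: arrow_def)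
    show 1: "d E (\<beta> E) (r T E) \<le> \<kappa>"
      using that b ET \<kappa> unfolding arrow_def consistent_def \<beta>_def by force
    show "d T (e T p) (r E T) \<le> k"
      using transverse_consistent[of E T p] ET 1 B \<kappa> b(2) tri[of E "e E p" "\<beta> E" "r T E"]
        sym[of E "\<beta> E" "r T E"] unfolding transverse_def by fastforce
  qed
  have arrow_trans: "arrow E1 E3" if "arrow E1 E2" "arrow E2 E3" for E1 E2 E3
  proof -
    have S: "E1 \<in> S" "E2 \<in> S" "E3 \<in> S" "E1 \<in> M" "E3 \<in> M" "E1 \<pitchfork> E2" "E2 \<pitchfork> E3"
      using that M by (auto simp: arrow_def)
    \<comment> \<open>In \<open>E2\<close> the point \<open>p\<close> is near \<open>r E1 E2\<close>
      and the tuple is near \<open>r E3 E2\<close>.\<close>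
    have far2: "B - \<kappa> - k \<le> d E2 (r E1 E2) (r E3 E2)"
      using arrowD[OF that(1)] arrowD[OF that(2)] M(2)[of E2] that
        tri[of E2 "e E2 p" "\<beta> E2" "r E1 E2"] tri[of E2 "r E1 E2" "\<beta> E2" "r E3 E2"]
        sym[of E2 "\<beta> E2" "r E3 E2"] unfolding arrow_def by linarith
    have "E1 \<noteq> E3" using far2 B b(2) \<kappa> by auto
    then have "\<not> E1 \<sqsubseteq> E3" "\<not> E3 \<sqsubseteq> E1"
      using S unfolding M_def by blast+
    \<comment> \<open>Otherwise partial realization of both domains gives one point near both
      \<open>r E1 E2\<close> and \<open>r E3 E2\<close>.\<close>
    moreover have "\<not> E1 \<bottom> E3"
    proof
      assume "E1 \<bottom> E3"
      then have "pairwise (\<bottom>) {E1, E3}" using orth_sym S by (auto simp: pairwise_insert)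
      then obtain q where "d E2 (e E2 q) (r E1 E2) \<le> k" "d E2 (e E2 q) (r E3 E2) \<le> k"
        using partial_realization[of "{E1, E3}" b] S transverse_sym[OF S(2,3)] unfolding transverse_def by auto
      then show False
        using far2 B b(2) \<kappa> tri[of E2 "r E1 E2" "r E3 E2" "e E2 q"] sym[of E2 "r E1 E2" "e E2 q"]
        by linarith
    qed
    ultimately have tr: "E1 \<pitchfork> E3" by (simp add: transverse_def)
    \<comment> \<open>The realization point \<open>w\<close> of \<open>E1\<close> serves to compare
      \<open>r E1 E3\<close> with \<open>r E2 E3\<close>. In \<open>E2\<close> it is near
      \<open>r E1 E2\<close>, hence far from \<open>r E3 E2\<close>, so in \<open>E3\<close> it must
      be near \<open>r E2 E3\<close>.\<close>
    obtain w where w: "d E2 (e E2 w) (r E1 E2) \<le> k" "d E3 (e E3 w) (r E1 E3) \<le> k"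
      using partial_realization[of "{E1}" b] S tr unfolding transverse_def by auto
    have "\<not> d E2 (e E2 w) (r E3 E2) \<le> k"
      using far2 B b(2) \<kappa> w(1) tri[of E2 "r E1 E2" "r E3 E2" "e E2 w"] sym[of E2 "r E1 E2" "e E2 w"]
      by linarith
    then have "d E3 (e E3 w) (r E2 E3) \<le> k"
      using transverse_consistent[of E2 E3 w] S unfolding transverse_def by blast
    then have "d E3 (e E3 p) (r E1 E3) \<le> 3 * k"
      using w(2) arrowD(2)[OF that(2)] tri[of E3 "e E3 p" "r E1 E3" "r E2 E3"]
        tri[of E3 "r E2 E3" "r E1 E3" "e E3 w"] sym[of E3 "r E2 E3" "e E3 w"] by linarith
    then have "2 * \<kappa> < d E3 (\<beta> E3) (r E1 E3)"
      using M(2)[OF S(5)] B b(2) \<kappa> tri[of E3 "e E3 p" "\<beta> E3" "r E1 E3"] sym[of E3 "\<beta> E3" "r E1 E3"]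
      by linarith
    then show ?thesis using S tr by (simp add: arrow_def)
  qed
  have "\<exists>E\<in>M. \<forall>T. \<not> arrow E T"
  proof (rule ccontr)
    assume "\<not> ?thesis"
    then have "\<forall>E\<in>M. \<exists>T. arrow E T" by blast
    then obtain g where g: "\<And>E. E \<in> M \<Longrightarrow> arrow E (g E)" by metis
    obtain E1 where E1: "E1 \<in> M" using ex_above[of E0] E0 by (auto simp: bad_def \<beta>_def)
    define f where "f i = (g ^^ i) E1" for i
    have fM: "f i \<in> M" for i
      by (induction i) (use E1 g arrow_def in \<open>auto simp: f_def\<close>)
    have step: "arrow (f i) (f (Suc i))" for i using g[OF fM[of i]] by (simp add: f_def)
    have arr: "arrow (f i) (f j)" if "i < j" for i j
      using that by (rule less_Suc_induct) (use step arrow_trans in blast)+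
    have "f i \<noteq> f j" if "i < j" for i j
      using arr[OF that] nested_refl[OF M(1)[OF fM]] by (auto simp: arrow_def transverse_def)
    then have inj: "inj f" by (metis injI linorder_neqE_nat)
    \<comment> \<open>This bounds the distance of \<open>p\<close> and \<open>q\<close> above the
      chain: at most \<open>B\<close> from \<open>p\<close> to the tuple,
      \<open>B + 2 * \<kappa>\<close> on to \<open>r (f m) T\<close>, and \<open>k\<close> on to
      \<open>q\<close>.\<close>
    define c where "c = 2 * B + 3 * \<kappa>"
    obtain N :: nat where N: "k * c + k \<le> real N" using real_arch_simple by blast
    define m where "m = (N + 1) ^ n + 1"
    obtain q where q: "\<And>W. W \<in> S \<Longrightarrow> f m \<sqsubset> W \<or> f m \<pitchfork> W \<Longrightarrow> d W (e W q) (r (f m) W) \<le> k"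
      using partial_realization[of "{f m}" b] M(1)[OF fM[of m]] unfolding transverse_def by auto
    have far_M: "\<kappa> + 2 * k < d (f m) (e (f m) p) (\<beta> (f m))"
      using M(2)[OF fM[of m]] B b(2) \<kappa> by linarith
    have "card (f ` {..<m}) \<le> (N + 1) ^ n"
    proof (rule card_relevant[OF N])
      show "f ` {..<m} \<subseteq> S" using M fM by auto
    next
      fix E assume "E \<in> f ` {..<m}"
      then have E: "E \<in> M" "arrow E (f m)" using fM arr by auto
      then have ES: "E \<in> S" "f m \<pitchfork> E" "B < d E (e E p) (\<beta> E)"
        using M transverse_sym fM unfolding arrow_def by blast+
      then show "k < d E (e E p) (e E q)"
        using q[of E] arrowD(1)[OF E(2)] B b(2) \<kappa> tri[of E "e E p" "\<beta> E" "r (f m) E"]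
          tri[of E "e E p" "r (f m) E" "e E q"] sym[of E "\<beta> E" "r (f m) E"] by linarith
    next
      fix E T assume "E \<in> f ` {..<m}" and T: "T \<in> S" "E \<sqsubset> T"
      then have E: "E \<in> M" "arrow E (f m)" using fM arr by auto
      have ES: "E \<in> S" "f m \<in> S" using E M fM by blast+
      have "\<not> f m \<bottom> T" "\<not> T \<sqsubseteq> f m"
        using E(2) T ES nested_trans[OF ES(1) T(1) ES(2)] orth_nested[of "f m" E T] orth_sym
        unfolding arrow_def transverse_def by blast+
      then have rel: "f m \<sqsubset> T \<or> f m \<pitchfork> T" using T by (auto simp: transverse_def)
      have near: "d T (e T p) (\<beta> T) \<le> B" using M_above E T by blast
      have "d T (\<beta> T) (r (f m) T) \<le> B + 2 * \<kappa>"
        using rel near_rho_above[OF b ES(2) T(1)] near_rho_transverse[OF b ES(2) T(1)] near far_M k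
        unfolding \<beta>_def by force
      then show "d T (e T p) (e T q) \<le> c"
        using near q[OF T(1) rel] tri[of T "e T p" "r (f m) T" "\<beta> T"]
          tri[of T "e T p" "e T q" "r (f m) T"] sym[of T "r (f m) T" "e T q"] b(2)
        unfolding c_def by linarith
    qed simp
    then show False using card_image[of f "{..<m}"] inj unfolding m_def by (simp add: inj_on_def)
  qed
  then obtain E where E: "E \<in> M" "\<And>T. \<not> arrow E T" by blast
  have ES: "E \<in> S" "B < d E (e E p) (\<beta> E)" using E M by auto
  have far: "\<kappa> + 2 * k < d E (e E p) (e E (b E))" "\<kappa> + k < d E (e E p) (e E (b E))"
    using ES(2) B b(2) \<kappa> k unfolding \<beta>_def by linarith+
  have "d T (\<beta> T) (r E T) \<le> B + 2 * \<kappa>" if T: "T \<in> S" "E \<sqsubset> T \<or> E \<pitchfork> T" for T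
  proof (cases "d T (e T p) (\<beta> T) \<le> B")
    case True
    then show ?thesis
      using T near_rho_above[OF b ES(1) T(1) _ far(1)] near_rho_transverse[OF b ES(1) T(1) _ far(2)]
      unfolding \<beta>_def by blast
  next
    case False
    then have tr: "E \<pitchfork> T" using T M_above E by blast
    \<comment> \<open>Here \<open>T\<close> is itself bad and is replaced by a maximal bad
      \<open>U\<close> above it. As no arrow leaves \<open>E\<close>, the tuple is near
      \<open>r E U\<close>. If it were far from \<open>r E T\<close>, it would be near
      \<open>r T E\<close> in \<open>E\<close>, hence near \<open>r U E\<close>; so \<open>p\<close>
      would be far from \<open>r U E\<close> and near \<open>r E U\<close>, that is, near the tuple
      in \<open>U\<close>.\<close>
    obtain U where U: "U \<in> M" "T \<sqsubseteq> U" using ex_above[of T] False T by (auto simp: bad_def)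
    have US: "U \<in> S" using U M by blast
    have "U \<noteq> E" using tr U by (auto simp: transverse_def)
    moreover have "\<not> E \<sqsubset> U" using E U M_def by blast
    ultimately have trU: "E \<pitchfork> U" using transverse_above ES T US U tr by metis
    then have nearU: "d U (\<beta> U) (r E U) \<le> 2 * \<kappa>"
      using E U by (force simp: arrow_def)
    show ?thesis
    proof (rule ccontr)
      assume not: "\<not> ?thesis"
      then have 1: "d E (\<beta> E) (r T E) \<le> \<kappa>"
        using b ES T tr B \<kappa> unfolding consistent_def \<beta>_def by force
      have "d E (r T E) (r U E) \<le> k"
        using rho_consistent[OF T(1) US ES(1) U(2)] transverse_sym[OF ES(1) US trU] tr
        unfolding transverse_def by blast
      then have "\<not> d E (e E p) (r U E) \<le> k"
        using 1 ES(2) B b(2) \<kappa> tri[of E "e E p" "\<beta> E" "r U E"] tri[of E "r U E" "\<beta> E" "r T E"]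
          sym[of E "\<beta> E" "r T E"] sym[of E "r T E" "r U E"] by linarith
      then have "d U (e U p) (r E U) \<le> k"
        using transverse_consistent[of E U p] trU ES US unfolding transverse_def by blast
      then show False
        using nearU M(2)[OF U(1)] B b(2) \<kappa> tri[of U "e U p" "\<beta> U" "r E U"] sym[of U "\<beta> U" "r E U"]
        by linarith
    qed
  qed
  then have "good b (B + 2 * \<kappa>) E" by (auto simp: good_def \<beta>_def)
  then show ?thesis using ES unfolding \<beta>_def by blast
qed

text \<open>Lower domains count more, and every domain of \<open>S\<close> counts at least 1, so the
  weight grows both when a domain is added and when one is replaced by a smaller one.\<close>

definition weight :: "'s set \<Rightarrow> nat" where
  "weight G = (\<Sum>U\<in>G. n + 1 - rk U)"

lemma weight_le:
  assumes "G \<subseteq> S" "pairwise (\<bottom>) G"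
  shows "weight G \<le> (n + 1) * (n + 1)"
proof -
  have "weight G \<le> (\<Sum>U\<in>G. n + 1)" unfolding weight_def by (intro sum_mono) simp
  also have "\<dots> = card G * (n + 1)" by simp
  also have "\<dots> \<le> (n + 1) * (n + 1)" using orthogonal_finite[OF assms] by (intro mult_right_mono) auto
  finally show ?thesis .
qed

text \<open>Replacing the elements of \<open>G\<close> above \<open>E\<close> by \<open>E\<close>: there is at most one of them.\<close>

lemma weight_refine:
  assumes G: "G \<subseteq> S" "pairwise (\<bottom>) G" and E: "E \<in> S" "E \<notin> G" "\<And>U. U \<in> G \<Longrightarrow> E \<sqsubseteq> U \<or> E \<bottom> U"
  defines "G' \<equiv> insert E {U\<in>G. E \<bottom> U}"
  shows "pairwise (\<bottom>) G'" "weight G < weight G'"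
proof -
  show "pairwise (\<bottom>) G'"
    using G E(1) orth_sym unfolding G'_def pairwise_insert pairwise_def by blast
  have fin: "finite G" using orthogonal_finite[OF G] by simp
  let ?A = "{U\<in>G. E \<bottom> U}" and ?B = "{U\<in>G. \<not> E \<bottom> U}"
  have "weight G = (\<Sum>U\<in>?A. n + 1 - rk U) + (\<Sum>U\<in>?B. n + 1 - rk U)"
    unfolding weight_def using fin by (subst sum.union_disjoint[symmetric]) (auto intro: sum.cong)
  moreover have "weight G' = (n + 1 - rk E) + (\<Sum>U\<in>?A. n + 1 - rk U)"
    unfolding weight_def G'_def using fin E(2) by simp
  moreover have "(\<Sum>U\<in>?B. n + 1 - rk U) < n + 1 - rk E"
  proof (cases "?B = {}")
    case True
    show ?thesis using rk_le[OF E(1)] unfolding True by simp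
  next
    case False
    then obtain U where U: "U \<in> G" "\<not> E \<bottom> U" by blast
    then have EU: "E \<sqsubset> U" using E by blast
    have "V = U" if "V \<in> G" "\<not> E \<bottom> V" for V
      using EU that U G E orth_nested[of V E U] orth_nested[of E U V]
      unfolding pairwise_def by (metis subsetD)
    then have "?B = {U}" using U by blast
    then show ?thesis
      using rk_less[of E U] EU U G E(1) rk_le[of U] by auto
  qed
  ultimately show "weight G < weight G'" by linarith
qed

text \<open>The induction on \<open>j\<close> carries the alternative that the tuple is realised or
  some orthogonal family of good domains has weight at least \<open>j\<close>. The second case is
  impossible beyond the bound on weights. Choosing \<open>\<theta>\<close> before the tuple at each
  stage keeps it uniform.\<close>

lemma realization:
  assumes "k \<le> \<kappa>"
  shows "\<exists>\<theta>. \<forall>b. consistent \<kappa> b \<longrightarrow> (\<exists>p. \<forall>V\<in>S. d V (e V p) (e V (b V)) \<le> \<theta>)"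
proof -
  have "\<exists>\<theta>. \<forall>b. consistent \<kappa> b \<longrightarrow> (\<exists>p. \<forall>V\<in>S. d V (e V p) (e V (b V)) \<le> \<theta>) \<or>
      (\<exists>G\<subseteq>S. pairwise (\<bottom>) G \<and> j \<le> weight G \<and> (\<forall>U\<in>G. good b \<theta> U))" for j
  proof (induction j)
    case 0
    show ?case by (rule exI, intro allI impI disjI2 exI[of _ "{}"]) auto
  next
    case (Suc j)
    then obtain \<theta> where \<theta>: "\<And>b. consistent \<kappa> b \<Longrightarrow> (\<exists>p. \<forall>V\<in>S. d V (e V p) (e V (b V)) \<le> \<theta>) \<or>
      (\<exists>G\<subseteq>S. pairwise (\<bottom>) G \<and> j \<le> weight G \<and> (\<forall>U\<in>G. good b \<theta> U))" by blast
    \<comment> \<open>\<open>10 * \<kappa>\<close> is required by \<open>exists_good\<close>;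
      \<open>\<theta> + k\<close> is the distance within which \<open>p\<close> agrees with the
      tuple in every domain above or transverse to an element of \<open>G\<close>.\<close>
    define B where "B = max (10 * \<kappa>) (\<theta> + k)"
    have B: "10 * \<kappa> \<le> B" "\<theta> + k \<le> B" "k \<le> B" using assms k by (auto simp: B_def)
    have "(\<exists>p. \<forall>V\<in>S. d V (e V p) (e V (b V)) \<le> B + 2 * \<kappa>) \<or>
      (\<exists>G\<subseteq>S. pairwise (\<bottom>) G \<and> Suc j \<le> weight G \<and> (\<forall>U\<in>G. good b (B + 2 * \<kappa>) U))"
      if b: "consistent \<kappa> b" for b
      using \<theta>[OF b]
    proof
      assume "\<exists>p. \<forall>V\<in>S. d V (e V p) (e V (b V)) \<le> \<theta>"
      moreover have "\<theta> \<le> B + 2 * \<kappa>" using B assms k by linarith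
      ultimately show ?thesis by (meson order_trans)
    next
      assume "\<exists>G\<subseteq>S. pairwise (\<bottom>) G \<and> j \<le> weight G \<and> (\<forall>U\<in>G. good b \<theta> U)"
      then obtain G where G: "G \<subseteq> S" "pairwise (\<bottom>) G" "j \<le> weight G"
        "\<And>U. U \<in> G \<Longrightarrow> good b \<theta> U" by blast
      obtain p where p: "\<And>V. V \<in> G \<Longrightarrow> d V (e V p) (e V (b V)) \<le> k"
          "\<And>V W. V \<in> G \<Longrightarrow> W \<in> S \<Longrightarrow> V \<sqsubset> W \<or> V \<pitchfork> W \<Longrightarrow> d W (e W p) (r V W) \<le> k"
        using partial_realization[OF G(1,2), of b] unfolding transverse_def by blast
      show ?thesis
      proof (cases "\<forall>V\<in>S. d V (e V p) (e V (b V)) \<le> B")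
        case True
        then have "\<forall>V\<in>S. d V (e V p) (e V (b V)) \<le> B + 2 * \<kappa>" using assms k by fastforce
        then show ?thesis by blast
      next
        case False
        then obtain E0 where "E0 \<in> S" "B < d E0 (e E0 p) (e E0 (b E0))" by force
        then obtain E where E: "E \<in> S" "B < d E (e E p) (e E (b E))" "good b (B + 2 * \<kappa>) E"
          using exists_good[OF b assms B(1)] by blast
        have "E \<notin> G" using p(1)[of E] E(2) B by linarith
        \<comment> \<open>Otherwise both \<open>p\<close> and the tuple are near
          \<open>r U E\<close>, the tuple because \<open>U\<close> is good, and \<open>E\<close>
          would not separate them by more than \<open>B\<close>.\<close>
        have EU: "E \<sqsubseteq> U \<or> E \<bottom> U" if "U \<in> G" for U
        proof (rule ccontr)
          assume "\<not> ?thesis"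
          then have "U \<sqsubset> E \<or> U \<pitchfork> E"
            using that \<open>E \<notin> G\<close> E(1) G(1) orth_sym unfolding transverse_def by blast
          then show False
            using p(2)[OF that E(1)] G(4)[OF that] E(1,2) B tri[of E "e E p" "e E (b E)" "r U E"]
              sym[of E "r U E" "e E (b E)"] unfolding good_def by fastforce
        qed
        let ?G = "insert E {U\<in>G. E \<bottom> U}"
        have "good b (B + 2 * \<kappa>) U" if "U \<in> G" for U
          using B assms k by (intro good_mono[OF G(4)[OF that]]) linarith
        then have "?G \<subseteq> S" "\<forall>U\<in>?G. good b (B + 2 * \<kappa>) U" using E G by auto
        moreover have "pairwise (\<bottom>) ?G" "Suc j \<le> weight ?G"
          using weight_refine[OF G(1,2) E(1) \<open>E \<notin> G\<close> EU] G(3) by auto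
        ultimately show ?thesis by blast
      qed
    qed
    then show ?case by blast
  qed
  from this[of "(n + 1) * (n + 1) + 1"] show ?thesis
    using weight_le by (metis Suc_eq_plus1 not_less_eq_eq)
qed

end

subsection \<open>Hulls and shortest chains\<close>

text \<open>A quasigeodesic with integer parameters; \<open>quasigeodesic_floor\<close> extends it
  to real ones.\<close>

definition quasi_chain :: "real \<Rightarrow> ('a \<Rightarrow> 'a \<Rightarrow> real) \<Rightarrow> nat \<Rightarrow> (nat \<Rightarrow> 'a) \<Rightarrow> bool" where
  "quasi_chain D \<delta> m h \<longleftrightarrow> (\<forall>i\<le>m. \<forall>j\<le>m. \<bar>real i - real j\<bar> / D - D \<le> \<delta> (h i) (h j) \<and>
     \<delta> (h i) (h j) \<le> D * \<bar>real i - real j\<bar> + D)"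

text \<open>The index \<open>\<iota> k\<close> is the last exit of \<open>a\<close> from \<open>[0, 2 J k]\<close>.\<close>

lemma last_exit_indices:
  fixes a :: "nat \<Rightarrow> real"
  assumes m: "0 < m" and J: "0 < J" and a0: "a 0 \<le> J" and nonneg: "\<And>i. i \<le> m \<Longrightarrow> 0 \<le> a i"
    and jump: "\<And>i. i < m \<Longrightarrow> \<bar>a (Suc i) - a i\<bar> \<le> J"
  shows "\<exists>K \<iota>. \<iota> 0 = 0 \<and> \<iota> K = m \<and> (\<forall>k<K. \<iota> k < \<iota> (Suc k)) \<and>
           (\<forall>k\<le>K. \<bar>a (\<iota> k) - 2 * J * real k\<bar> \<le> 2 * J)"
proof -
  obtain K0 :: nat where "a m / (2 * J) \<le> real K0" using real_arch_simple by blast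
  then have "a m \<le> 2 * J * real (Suc K0)" using J by (simp add: field_simps)
  then have ex: "\<exists>k. a m \<le> 2 * J * real (Suc k)" by blast
  define K where "K = (LEAST k. a m \<le> 2 * J * real (Suc k))"
  have K: "a m \<le> 2 * J * real (Suc K)" unfolding K_def by (rule LeastI_ex[OF ex])
  have K_less: "2 * J * real k < a m" if "0 < k" "k \<le> K" for k
    using not_less_Least[of "k - 1" "\<lambda>k. a m \<le> 2 * J * real (Suc k)"] that unfolding K_def by force
  define A where "A k = {i. i \<le> m \<and> a i \<le> 2 * J * real k}" for k
  \<comment> \<open>The first and last indices are prescribed. By the choice of \<open>K\<close>,
    the levels \<open>2 * J * k\<close> with \<open>0 < k \<le> K\<close> lie below
    \<open>a m\<close>, so their last exits occur before \<open>m\<close>.\<close>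
  define \<iota> where "\<iota> k = (if k = 0 then 0 else if k = Suc K then m else Max (A k))" for k
  have A: "finite (A k)" "0 \<in> A k" if "0 < k" for k
  proof -
    have "J * 1 \<le> J * real k" using that J by (intro mult_left_mono) auto
    then have "a 0 \<le> 2 * J * real k" using a0 J unfolding mult.assoc by linarith
    then show "0 \<in> A k" by (simp add: A_def)
  qed (simp add: A_def)
  have mid: "\<iota> k < m" "a (\<iota> k) \<le> 2 * J * real k" "2 * J * real k - J < a (\<iota> k)"
    if k: "0 < k" "k \<le> K" for k
  proof -
    have eq: "\<iota> k = Max (A k)" using k by (simp add: \<iota>_def)
    moreover have "A k \<noteq> {}" using A(2)[OF k(1)] by blast
    ultimately have "\<iota> k \<in> A k" using Max_in[OF A(1)[OF k(1)]] by simp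
    moreover have "m \<notin> A k" using K_less[OF k] by (simp add: A_def)
    ultimately show lt: "\<iota> k < m" and "a (\<iota> k) \<le> 2 * J * real k"
      by (auto simp: A_def le_less)
    \<comment> \<open>One step later \<open>a\<close> is above the level, and a step changes it by
      at most \<open>J\<close>.\<close>
    have "Suc (\<iota> k) \<notin> A k" using Max_ge[OF A(1)[OF k(1)], of "Suc (\<iota> k)"] eq by auto
    then show "2 * J * real k - J < a (\<iota> k)" using jump[OF lt] lt by (auto simp: A_def)
  qed
  have "\<iota> k < \<iota> (Suc k)" if "k < Suc K" for k
  proof (cases "k = K")
    case True
    then show ?thesis using mid[of K] m by (cases "K = 0") (auto simp: \<iota>_def)
  next
    case False
    then have kK: "0 < Suc k" "Suc k \<le> K" using that by auto
    show ?thesis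
    proof (cases "k = 0")
      case True
      have "\<iota> (Suc 0) \<noteq> 0"
      proof
        assume "\<iota> (Suc 0) = 0"
        then show False using mid(3)[OF kK] True a0 by simp
      qed
      then show ?thesis using True by (simp add: \<iota>_def)
    next
      case k0: False
      show ?thesis
      proof (rule ccontr)
        assume "\<not> ?thesis"
        moreover have "\<iota> k \<in> A (Suc k)"
          using mid[of k] k0 kK J by (auto simp: A_def algebra_simps)
        moreover have "\<iota> (Suc k) = Max (A (Suc k))" using kK by (simp add: \<iota>_def)
        \<comment> \<open>Equality is impossible: at its last exit \<open>a\<close> is less than
          \<open>J\<close> below its level, and consecutive levels are \<open>2 * J\<close>
          apart.\<close>
        ultimately have "\<iota> (Suc k) = \<iota> k"
          using Max_ge[OF A(1)[OF kK(1)], of "\<iota> k"] by linarith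
        then show False using mid(3)[OF kK] mid(2)[of k] k0 kK J by (auto simp: algebra_simps)
      qed
    qed
  qed
  moreover have "\<bar>a (\<iota> k) - 2 * J * real k\<bar> \<le> 2 * J" if k: "k \<le> Suc K" for k
  proof -
    consider "k = 0" | "k = Suc K" | "0 < k" "k \<le> K" using k by linarith
    then show ?thesis
    proof cases
      case 1
      then show ?thesis using a0 nonneg[of 0] J by (simp add: \<iota>_def)
    next
      case 2
      then show ?thesis
        using K K_less[of K] nonneg[of m] J by (cases "K = 0") (auto simp: \<iota>_def algebra_simps)
    next
      case 3
      then show ?thesis using mid[OF 3] J by auto
    qed
  qed
  ultimately show ?thesis
    by (intro exI[of _ "Suc K"] exI[of _ \<iota>]) (auto simp: \<iota>_def)
qed

text \<open>A shortcut between two of its points would shorten the whole path, so every subpath is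
  shortest too. This is what converts paths of linear length into a lower bound on
  distances.\<close>

lemma ex_shortest_relpowp:
  fixes P :: "'a \<Rightarrow> 'a \<Rightarrow> bool"
  assumes "(P ^^ m0) x y"
  shows "\<exists>m h. h 0 = x \<and> h m = y \<and> (\<forall>i<m. P (h i) (h (Suc i))) \<and>
           (\<forall>i j l. i \<le> j \<longrightarrow> j \<le> m \<longrightarrow> (P ^^ l) (h i) (h j) \<longrightarrow> j - i \<le> l)"
proof -
  define m where "m = (LEAST m. (P ^^ m) x y)"
  have "(P ^^ m) x y" unfolding m_def using assms by (rule LeastI)
  then obtain h where h: "h 0 = x" "h m = y" "\<And>i. i < m \<Longrightarrow> P (h i) (h (Suc i))"
    by (auto simp: relpowp_fun_conv)
  have "j - i \<le> l" if ij: "i \<le> j" "j \<le> m" and l: "(P ^^ l) (h i) (h j)" for i j l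
  proof -
    have "(P ^^ i) x (h i)" using h ij by (auto simp: relpowp_fun_conv)
    moreover have "(P ^^ (m - j)) (h j) y"
      unfolding relpowp_fun_conv by (rule exI[of _ "\<lambda>t. h (j + t)"]) (use h ij in auto)
    ultimately have "(P ^^ (i + l + (m - j))) x y"
      using l unfolding relpowp_add by blast
    then have "m \<le> i + l + (m - j)" unfolding m_def by (rule Least_le)
    then show ?thesis using ij by linarith
  qed
  then show ?thesis using h by blast
qed

context coarse_hierarchy begin

section \<open>Retraction of the space to a hull\<close>

lemma ex_rail:
  assumes "W \<in> S"
  shows "\<exists>Q f. rail (d W) (10 * k + 2) a b Q f \<and>
    ((\<exists>V\<in>S. V \<sqsubset> W) \<longrightarrow> (\<forall>p w. btw (d W) a w b \<longrightarrow> d W p (f p) \<le> d W p w + 1))"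
proof (cases "\<exists>V\<in>S. V \<sqsubset> W")
  case True
  then show ?thesis
    using geodesic_pseudometric.rail_slim[OF pm, of k W a b] hyperbolic assms k by fastforce
next
  case False
  then show ?thesis
    using geodesic_pseudometric.rail_segment[OF pm, of "10 * k + 2" W a b] k by fastforce
qed

text \<open>If \<open>t\<close> is near both endpoints, the whole interval is short. If it is near
  \<open>p\<close> and one endpoint \<open>z\<close>, then \<open>p\<close> is near
  \<open>z\<close>, so \<open>f p\<close> is near \<open>f z\<close>, which is near
  \<open>z\<close>. The factor 7 is \<open>3 * 2 + 1\<close>, with 3 the Lipschitz constant of
  rails.\<close>

lemma rail_two_of_three:
  assumes f: "rail (d V) C x y Q f" "0 \<le> C" and u: "d V u (f p) \<le> k" and c: "0 \<le> c"
    and t: "d V x t \<le> c \<and> d V y t \<le> c \<or> d V x t \<le> c \<and> d V p t \<le> c \<or> d V y t \<le> c \<and> d V p t \<le> c"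
  shows "d V u t \<le> 7 * c + 2 * C + k"
proof -
  have *: "d V (f p) t \<le> 7 * c + 2 * C" if "d V z t \<le> c" "d V p t \<le> c" "d V z (f z) \<le> C" for z
  proof -
    have "d V p z \<le> 2 * c" using that tri[of V p z t] sym[of V z t] by linarith
    moreover have "d V (f p) (f z) \<le> 3 * d V p z + C" using f(1) by (simp add: rail_def)
    ultimately show ?thesis
      using that tri[of V "f p" t "f z"] tri[of V "f z" t z] sym[of V z "f z"] by linarith
  qed
  have "d V (f p) t \<le> 7 * c + 2 * C"
    using t
  proof (elim disjE conjE)
    assume "d V x t \<le> c" "d V y t \<le> c"
    moreover have "btw (d V) x (f p) y" using f(1) by (auto simp: rail_def)
    ultimately show ?thesis
      using tri[of V "f p" t x] tri[of V x y t] sym[of V y t] sym[of V x "f p"] c f(2)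
        d_nonneg[of V "f p" y]
      unfolding btw_def by linarith
  next
    assume "d V x t \<le> c" "d V p t \<le> c"
    moreover have "d V x (f x) \<le> C" using f(1) by (simp add: rail_def)
    ultimately show ?thesis using * by blast
  next
    assume "d V y t \<le> c" "d V p t \<le> c"
    moreover have "d V y (f y) \<le> C" using f(1) by (simp add: rail_def)
    ultimately show ?thesis using * by blast
  qed
  then show ?thesis using u tri[of V u t "f p"] by linarith
qed

text \<open>
  For \<open>V \<sqsubset> W\<close> the legs from \<open>b = f W (e W p)\<close> to the coordinates of \<open>x\<close>, \<open>y\<close> and \<open>p\<close> diverge, so that
  \<open>\<rho>\<^sup>V\<^sub>W\<close>, when far from \<open>b\<close>, is close to at most one of them, and bounded geodesic image applies to
  the other two.
\<close>

lemma consistent_retraction: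
  assumes rail: "\<And>W. W \<in> S \<Longrightarrow> rail (d W) (10 * k + 2) (e W x) (e W y) (Q W) (f W)"
    and near: "\<And>W V p w. W \<in> S \<Longrightarrow> V \<in> S \<Longrightarrow> V \<sqsubset> W \<Longrightarrow> btw (d W) (e W x) w (e W y) \<Longrightarrow>
          d W p (f W p) \<le> d W p w + 1"
    and u: "\<And>W. W \<in> S \<Longrightarrow> d W (e W (u W)) (f W (e W p)) \<le> k"
  shows "consistent (40 * k) u"
  unfolding consistent_def
proof (intro ballI conjI impI)
  fix V W assume VW: "V \<in> S" "W \<in> S" "V \<pitchfork> W"
  have "d W (e W z) (r V W) \<le> k \<or> d V (e V z) (r W V) \<le> k" for z
    using transverse_consistent VW unfolding transverse_def by blast
  from this[of x] this[of y] this[of p]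
  show "d W (e W (u W)) (r V W) \<le> 40 * k \<or> d V (e V (u V)) (r W V) \<le> 40 * k"
    using rail_two_of_three[OF rail[OF VW(1)] _ u[OF VW(1)], of k "r W V"]
      rail_two_of_three[OF rail[OF VW(2)] _ u[OF VW(2)], of k "r V W"] k by argo
next
  fix V W assume "V \<in> S" "W \<in> S" "V \<sqsubset> W"
  then have VW: "V \<in> S" "W \<in> S" "V \<sqsubseteq> W" "V \<noteq> W" by auto
  define b where "b = f W (e W p)"
  have bI: "btw (d W) (e W x) b (e W y)"
    using rail[OF VW(2)] by (auto simp: rail_def b_def)
  show "d W (e W (u W)) (r V W) \<le> 40 * k \<or> d V (e V (u V)) (s W V (e W (u W))) \<le> 40 * k"
  \<comment> \<open>The threshold is what remains if \<open>r V W\<close> is within \<open>k\<close>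
    of the leg to \<open>p\<close> and of a leg to an endpoint, where \<open>b\<close> is a closest
    point to \<open>p\<close> up to 1.\<close>
  proof (cases "d W b (r V W) \<le> 3 * k + 1")
    case True
    then show ?thesis using u[OF VW(2)] tri[of W "e W (u W)" "r V W" b] k by (auto simp: b_def)
  next
    case far: False
    define close where "close z \<longleftrightarrow> (\<exists>w. btw (d W) b w (e W z) \<and> d W w (r V W) \<le> k)" for z
    \<comment> \<open>The coordinate of \<open>z\<close> is the end of its leg, hence far from
      \<open>r V W\<close>, and consistency applies to \<open>z\<close>; bounded geodesic image then
      moves along the leg to \<open>b\<close>.\<close>
    have not_close: "d V (e V z) (s W V b) \<le> 2 * k" if "\<not> close z" for z
    proof -
      have "btw (d W) b (e W z) (e W z)" by (simp add: btw_def)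
      then have "d V (e V z) (s W V (e W z)) \<le> k"
        using that nested_consistent[OF VW, of z] by (auto simp: close_def)
      moreover have "d V (s W V (e W z)) (s W V b) \<le> k"
        using that bounded_image[OF VW, of b "e W z"] sym by (auto simp: close_def)
      ultimately show ?thesis using tri[of V "e V z" "s W V b" "s W V (e W z)"] by linarith
    qed
    have "\<not> (close x \<and> close y)"
    proof
      assume "close x \<and> close y"
      then obtain v w where "btw (d W) b v (e W x)" "d W v (r V W) \<le> k"
          "btw (d W) b w (e W y)" "d W w (r V W) \<le> k" by (auto simp: close_def)
      then show False
        using bI far tri[of W b "r V W" v] tri[of W "e W x" "e W y" v] tri[of W v "e W y" w]
          tri[of W v w "r V W"] sym[of W w "r V W"] sym[of W "e W x" b] sym[of W "e W x" v]
          d_nonneg[of W b w] k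
        unfolding btw_def by linarith
    qed
    moreover have "\<not> (close z \<and> close p)" if z: "z = x \<or> z = y" for z
    proof
      assume "close z \<and> close p"
      then obtain v w where v: "btw (d W) b v (e W z)" "d W v (r V W) \<le> k"
          and w: "btw (d W) b w (e W p)" "d W w (r V W) \<le> k" by (auto simp: close_def)
      have "btw (d W) (e W x) v (e W y)"
        using z
      proof
        assume "z = x"
        then show ?thesis
          using v(1) geodesic_pseudometric.btw_trans[OF pm bI] geodesic_pseudometric.btw_sym[OF pm]
          by blast
      next
        assume "z = y"
        moreover have "btw (d W) (e W y) b (e W x)"
          using bI geodesic_pseudometric.btw_sym[OF pm] by blast
        ultimately show ?thesis
          using v(1) geodesic_pseudometric.btw_trans[OF pm, of W "e W y" b "e W x" v]
            geodesic_pseudometric.btw_sym[OF pm] by blast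
      qed
      then have "d W (e W p) b \<le> d W (e W p) v + 1" using near VW b_def by blast
      then show False
        using v w far tri[of W "e W p" v w] tri[of W w v "r V W"] tri[of W b "r V W" w]
          sym[of W v "r V W"] sym[of W w "e W p"] sym[of W b "e W p"]
        unfolding btw_def by linarith
    qed
    ultimately have two: "d V (e V x) (s W V b) \<le> 2 * k \<and> d V (e V y) (s W V b) \<le> 2 * k \<or>
        d V (e V x) (s W V b) \<le> 2 * k \<and> d V (e V p) (s W V b) \<le> 2 * k \<or>
        d V (e V y) (s W V b) \<le> 2 * k \<and> d V (e V p) (s W V b) \<le> 2 * k"
      using not_close by blast
    have "d V (e V (u V)) (s W V b) \<le> 7 * (2 * k) + 2 * (10 * k + 2) + k"
      by (rule rail_two_of_three[OF rail[OF VW(1)] _ u[OF VW(1)] _ two]) (use k in auto)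
    then have 1: "d V (e V (u V)) (s W V b) \<le> 35 * k + 4" by simp
    \<comment> \<open>The coordinate of \<open>u W\<close> is within \<open>k\<close> of
      \<open>b\<close>, so the interval between them is too short to come near
      \<open>r V W\<close>.\<close>
    have "d V (s W V b) (s W V (e W (u W))) \<le> k"
    proof (rule ccontr)
      assume "\<not> ?thesis"
      then obtain z where "btw (d W) b z (e W (u W))" "d W z (r V W) \<le> k"
        using bounded_image[OF VW] by blast
      then show False
        using far u[OF VW(2)] tri[of W b "r V W" z] sym[of W b "e W (u W)"]
          d_nonneg[of W z "e W (u W)"] k
        unfolding btw_def b_def by linarith
    qed
    then have "d V (e V (u V)) (s W V (e W (u W))) \<le> 40 * k"
      using 1 tri[of V "e V (u V)" "s W V (e W (u W))" "s W V b"] k by linarith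
    then show ?thesis ..
  qed
qed

definition rail_hull :: "real \<Rightarrow> ('s \<Rightarrow> 'c set) \<Rightarrow> 'x set" where
  "rail_hull c Q = {z. \<forall>W\<in>S. \<exists>w\<in>Q W. d W (e W z) w \<le> c}"

lemma hull_retraction:
  "\<exists>c D. \<forall>x y. \<exists>Q f R. (\<forall>W\<in>S. rail (d W) (10 * k + 2) (e W x) (e W y) (Q W) (f W)) \<and>
     x \<in> rail_hull c Q \<and> y \<in> rail_hull c Q \<and> (\<forall>p. R p \<in> rail_hull c Q) \<and>
     (\<forall>z\<in>rail_hull c Q. dX z (R z) \<le> D) \<and> (\<forall>p q. dX p q \<le> k \<longrightarrow> dX (R p) (R q) \<le> D)"
proof -
  obtain \<theta> where \<theta>: "\<And>b. consistent (40 * k) b \<Longrightarrow> \<exists>p. \<forall>V\<in>S. d V (e V p) (e V (b V)) \<le> \<theta>"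
    using realization[of "40 * k"] k by auto
  \<comment> \<open>A realised retract is within \<open>\<theta> + k\<close> of the rail. The other
    term puts \<open>x\<close> and \<open>y\<close> into the hull, since rails fix their ends only
    up to \<open>10 * k + 2\<close>.\<close>
  define c where "c = max (\<theta> + k) (10 * k + 2)"
  define t where "t = k * k + k"
  \<comment> \<open>The terms bound, in each coordinate, the displacement of a hull point under
    \<open>R\<close> and the distance of the images of two points at distance at most
    \<open>k\<close>; \<open>t\<close> bounds the distance of their own coordinates.\<close>
  define c' where "c' = max (5 * c + 20 * k + 4) (3 * t + 10 * k + 2 + 2 * c)"
  obtain D where D: "\<And>x y. (\<forall>V\<in>S. d V (e V x) (e V y) \<le> c') \<Longrightarrow> dX x y \<le> D"
    using uniqueness by blast
  show ?thesis
  proof (rule exI[of _ c], rule exI[of _ D], intro allI)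
    fix x y
    have "\<forall>W\<in>S. \<exists>Q f. rail (d W) (10 * k + 2) (e W x) (e W y) Q f \<and>
        ((\<exists>V\<in>S. V \<sqsubset> W) \<longrightarrow>
          (\<forall>p w. btw (d W) (e W x) w (e W y) \<longrightarrow> d W p (f p) \<le> d W p w + 1))"
      using ex_rail by blast
    then have "\<exists>Q f. \<forall>W\<in>S. rail (d W) (10 * k + 2) (e W x) (e W y) (Q W) (f W) \<and>
        ((\<exists>V\<in>S. V \<sqsubset> W) \<longrightarrow>
          (\<forall>p w. btw (d W) (e W x) w (e W y) \<longrightarrow> d W p (f W p) \<le> d W p w + 1))"
      unfolding bchoice_iff by blast
    then obtain Q f where
        rail: "\<And>W. W \<in> S \<Longrightarrow> rail (d W) (10 * k + 2) (e W x) (e W y) (Q W) (f W)" and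
        near: "\<And>W V p w. W \<in> S \<Longrightarrow> V \<in> S \<Longrightarrow> V \<sqsubset> W \<Longrightarrow> btw (d W) (e W x) w (e W y) \<Longrightarrow>
          d W p (f W p) \<le> d W p w + 1"
      by blast
    have fQ: "f W p \<in> Q W" if "W \<in> S" for W p
      using rail[OF that] by (simp add: rail_def)
    have "\<exists>z. \<forall>W\<in>S. d W (e W z) (f W (e W p)) \<le> c" for p
    proof -
      have "\<exists>z. W \<in> S \<longrightarrow> d W (e W z) (f W (e W p)) \<le> k" for W
        using quasiconvex rail fQ unfolding rail_def by blast
      then obtain u where u: "\<And>W. W \<in> S \<Longrightarrow> d W (e W (u W)) (f W (e W p)) \<le> k" by metis
      have "consistent (40 * k) u"
        by (rule consistent_retraction[where Q = Q and f = f and x = x and y = y and p = p])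
          (use rail near u in blast)+
      then obtain z where z: "\<forall>W\<in>S. d W (e W z) (e W (u W)) \<le> \<theta>"
        using \<theta> by blast
      have "d W (e W z) (f W (e W p)) \<le> c" if "W \<in> S" for W
        using z u[OF that] that tri[of W "e W z" "f W (e W p)" "e W (u W)"] unfolding c_def by fastforce
      then show ?thesis by blast
    qed
    then obtain R where R: "\<And>p W. W \<in> S \<Longrightarrow> d W (e W (R p)) (f W (e W p)) \<le> c" by metis
    have lip: "d W (f W a) (f W b) \<le> 3 * d W a b + (10 * k + 2)" if "W \<in> S" for W a b
      using rail[OF that] unfolding rail_def by blast
    have "R p \<in> rail_hull c Q" for p
      using R fQ unfolding rail_hull_def by blast
    moreover have "z \<in> rail_hull c Q" if z: "z = x \<or> z = y" for z
    proof -
      have "d W (e W z) (f W (e W z)) \<le> c" if "W \<in> S" for W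
        using rail[OF that] z unfolding c_def rail_def by fastforce
      then show ?thesis using fQ unfolding rail_hull_def by blast
    qed
    moreover have "dX z (R z) \<le> D" if z: "z \<in> rail_hull c Q" for z
    proof (rule D, intro ballI)
      fix W assume W: "W \<in> S"
      then obtain w where w: "w \<in> Q W" "d W (e W z) w \<le> c" using z by (auto simp: rail_hull_def)
      have "d W w (f W w) \<le> 10 * k + 2" using rail[OF W] w unfolding rail_def by blast
      then have "d W (e W z) (e W (R z)) \<le> 5 * c + 20 * k + 4"
        using w(2) lip[OF W, of w "e W z"] R[OF W, of z] tri[of W "e W z" "e W (R z)" w]
          tri[of W w "e W (R z)" "f W w"] tri[of W "f W w" "e W (R z)" "f W (e W z)"]
          sym[of W w "e W z"] sym[of W "e W (R z)" "f W (e W z)"] by linarith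
      then show "d W (e W z) (e W (R z)) \<le> c'" by (simp add: c'_def)
    qed
    moreover have "dX (R p) (R q) \<le> D" if pq: "dX p q \<le> k" for p q
    proof (rule D, intro ballI)
      fix W assume W: "W \<in> S"
      have "d W (e W p) (e W q) \<le> t"
        using lipschitz[OF W, of p q] mult_left_mono[OF pq, of k] k unfolding t_def by linarith
      then have "d W (e W (R p)) (e W (R q)) \<le> 3 * t + 10 * k + 2 + 2 * c"
        using lip[OF W, of "e W p" "e W q"] R[OF W, of p] R[OF W, of q]
          tri[of W "e W (R p)" "e W (R q)" "f W (e W p)"]
          tri[of W "f W (e W p)" "e W (R q)" "f W (e W q)"]
          sym[of W "e W (R q)" "f W (e W q)"] by linarith
      then show "d W (e W (R p)) (e W (R q)) \<le> c'" by (simp add: c'_def)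
    qed
    ultimately show "\<exists>Q f R. (\<forall>W\<in>S. rail (d W) (10 * k + 2) (e W x) (e W y) (Q W) (f W)) \<and>
        x \<in> rail_hull c Q \<and> y \<in> rail_hull c Q \<and> (\<forall>p. R p \<in> rail_hull c Q) \<and>
        (\<forall>z\<in>rail_hull c Q. dX z (R z) \<le> D) \<and> (\<forall>p q. dX p q \<le> k \<longrightarrow> dX (R p) (R q) \<le> D)"
      using rail by blast
  qed
qed

section \<open>Quasigeodesics inside a hull\<close>

lemma relpowp_retracted_chain:
  assumes R: "\<And>p. R p \<in> H" "\<And>z. z \<in> H \<Longrightarrow> dX z (R z) \<le> D"
      "\<And>p q. dX p q \<le> k \<Longrightarrow> dX (R p) (R q) \<le> D"
    and z: "z \<in> H" "z' \<in> H"
  shows "\<exists>l. real l \<le> k * dX z z' + k + 2 \<and> ((\<lambda>u v. u \<in> H \<and> v \<in> H \<and> dX u v \<le> D) ^^ l) z z'"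
proof -
  let ?P = "\<lambda>u v. u \<in> H \<and> v \<in> H \<and> dX u v \<le> D"
  obtain m c where c: "c 0 = z" "c m = z'" "real m \<le> k * dX z z' + k"
      "\<And>i. i < m \<Longrightarrow> dX (c i) (c (Suc i)) \<le> k"
    using chains by blast
  have "(?P ^^ m) (R z) (R z')"
    unfolding relpowp_fun_conv by (rule exI[of _ "\<lambda>i. R (c i)"]) (use c R in auto)
  \<comment> \<open>The retracted chain joins \<open>R z\<close> to \<open>R z'\<close>; two further
    steps reach the given ends.\<close>
  moreover have "?P z (R z)" "?P (R z') z'" using R z dX_sym by metis+
  ultimately have "(?P ^^ Suc (Suc m)) z z'"
    by (metis (no_types, lifting) relpowp_Suc_I relpowp_Suc_I2)
  then show ?thesis using c(3) by (intro exI[of _ "Suc (Suc m)"]) auto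
qed

lemma dX_nonneg: "0 \<le> dX x y"
  using dX_tri[of x x y] dX_sym[of x y] by simp

lemma dX_chain_le:
  assumes "\<And>i. i < m \<Longrightarrow> dX (h i) (h (Suc i)) \<le> D"
  shows "i \<le> j \<Longrightarrow> j \<le> m \<Longrightarrow> dX (h i) (h j) \<le> D * (real j - real i)"
proof (induction j)
  case (Suc j)
  show ?case
  proof (cases "i = Suc j")
    case False
    then show ?thesis
      using Suc assms[of j] dX_tri[of "h i" "h (Suc j)" "h j"] by (simp add: algebra_simps)
  qed simp
qed simp

lemma hierarchy_chain:
  "\<exists>D\<ge>1. \<forall>x y. \<exists>m h. h 0 = x \<and> h m = y \<and> quasi_chain D dX m h \<and>
     (\<forall>W\<in>S. \<exists>K \<iota>. \<iota> 0 = 0 \<and> \<iota> K = m \<and> (\<forall>i<K. \<iota> i < \<iota> (Suc i)) \<and>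
        quasi_chain D (d W) K (\<lambda>i. e W (h (\<iota> i))))"
proof -
  obtain c D where hr: "\<And>x y. \<exists>Q f R. (\<forall>W\<in>S. rail (d W) (10 * k + 2) (e W x) (e W y) (Q W) (f W)) \<and>
     x \<in> rail_hull c Q \<and> y \<in> rail_hull c Q \<and> (\<forall>p. R p \<in> rail_hull c Q) \<and>
     (\<forall>z\<in>rail_hull c Q. dX z (R z) \<le> D) \<and> (\<forall>p q. dX p q \<le> k \<longrightarrow> dX (R p) (R q) \<le> D)"
    using hull_retraction by blast
  \<comment> \<open>One step of the path moves a coordinate by at most \<open>k * D + k\<close>;
    passing to nearby points of the rail costs \<open>c\<close> at either end. That \<open>c\<close>
    is nonnegative is known only once the hull has a point, hence the absolute value.\<close>
  define J where "J = k * D + k + 2 * \<bar>c\<bar>"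
  \<comment> \<open>The total error of replacing a coordinate distance by \<open>2 * J\<close> times
    the index difference: \<open>2 * c\<close> for passing to the rail, \<open>10 * k + 2\<close>
    for its thickness, and \<open>2 * J\<close> at each of the two sampled indices.\<close>
  define Z where "Z = 2 * \<bar>c\<bar> + (10 * k + 2) + 4 * J"
  define D' where "D' = Max {k + 2, D, 2 * J, Z}"
  have D': "k + 2 \<le> D'" "D \<le> D'" "2 * J \<le> D'" "Z \<le> D'" "1 \<le> D'"
    using k by (auto simp: D'_def)
  have "\<exists>m h. h 0 = x \<and> h m = y \<and> quasi_chain D' dX m h \<and>
     (\<forall>W\<in>S. \<exists>K \<iota>. \<iota> 0 = 0 \<and> \<iota> K = m \<and> (\<forall>i<K. \<iota> i < \<iota> (Suc i)) \<and>
        quasi_chain D' (d W) K (\<lambda>i. e W (h (\<iota> i))))" for x y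
  proof -
    obtain Q f R where rail: "\<And>W. W \<in> S \<Longrightarrow> rail (d W) (10 * k + 2) (e W x) (e W y) (Q W) (f W)"
      and xy: "x \<in> rail_hull c Q" "y \<in> rail_hull c Q"
      and R: "\<And>p. R p \<in> rail_hull c Q" "\<And>z. z \<in> rail_hull c Q \<Longrightarrow> dX z (R z) \<le> D"
        "\<And>p q. dX p q \<le> k \<Longrightarrow> dX (R p) (R q) \<le> D"
      using hr[of x y] by blast
    have D0: "0 \<le> D" using R(3)[of x x] k by simp
    have kD: "0 \<le> k * D" using D0 k by simp
    then have J: "1 \<le> J" using k unfolding J_def by linarith
    let ?H = "rail_hull c Q"
    let ?P = "\<lambda>u v. u \<in> ?H \<and> v \<in> ?H \<and> dX u v \<le> D"
    note chain = relpowp_retracted_chain[of R ?H D, OF R]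
    obtain m0 where "(?P ^^ m0) x y" using chain xy by blast
    from ex_shortest_relpowp[OF this] obtain m h where h: "h 0 = x" "h m = y"
        "\<And>i. i < m \<Longrightarrow> h i \<in> ?H \<and> h (Suc i) \<in> ?H \<and> dX (h i) (h (Suc i)) \<le> D"
        "\<And>i j l. i \<le> j \<Longrightarrow> j \<le> m \<Longrightarrow> (?P ^^ l) (h i) (h j) \<Longrightarrow> j - i \<le> l"
      by blast
    have hH: "h i \<in> ?H" if "i \<le> m" for i
      using h that xy by (cases "i = m") auto
    have up: "dX (h i) (h j) \<le> D' * \<bar>real i - real j\<bar> + D' \<and>
        \<bar>real i - real j\<bar> / D' - D' \<le> dX (h i) (h j)" if ij: "i \<le> j" "j \<le> m" for i j
    proof
      have "dX (h i) (h j) \<le> D * (real j - real i)"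
        using dX_chain_le[of m h D i j] h(3) ij by blast
      also have "\<dots> \<le> D' * (real j - real i)" using D' ij by (intro mult_right_mono) auto
      finally show "dX (h i) (h j) \<le> D' * \<bar>real i - real j\<bar> + D'" using D' ij by simp
      \<comment> \<open>The hull has a path of length \<open>l\<close> between these points, and a
        shortest path takes no more steps.\<close>
      obtain l where "real l \<le> k * dX (h i) (h j) + k + 2" "(?P ^^ l) (h i) (h j)"
        using chain hH ij by (meson order_trans)
      then have "real j - real i \<le> k * dX (h i) (h j) + k + 2"
        using h(4)[OF ij, of l] ij by linarith
      also have "\<dots> \<le> D' * dX (h i) (h j) + D' * D'"
      proof -
        have "k * dX (h i) (h j) \<le> D' * dX (h i) (h j)"
          using D' k dX_nonneg[of "h i" "h j"] by (intro mult_right_mono) auto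
        moreover have "D' * 1 \<le> D' * D'" using D' by (intro mult_left_mono) auto
        ultimately show ?thesis using D' by linarith
      qed
      finally show "\<bar>real i - real j\<bar> / D' - D' \<le> dX (h i) (h j)"
        using D' ij by (simp add: field_simps)
    qed
    have "quasi_chain D' dX m h"
      unfolding quasi_chain_def
    proof (intro allI impI)
      fix i j assume "i \<le> m" "j \<le> m"
      then show "\<bar>real i - real j\<bar> / D' - D' \<le> dX (h i) (h j) \<and>
          dX (h i) (h j) \<le> D' * \<bar>real i - real j\<bar> + D'"
        using up[of i j] up[of j i] dX_sym[of "h i" "h j"] abs_minus_commute[of "real i" "real j"]
        by (cases "i \<le> j") auto
    qed
    moreover have "\<exists>K \<iota>. \<iota> 0 = 0 \<and> \<iota> K = m \<and> (\<forall>i<K. \<iota> i < \<iota> (Suc i)) \<and>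
        quasi_chain D' (d W) K (\<lambda>i. e W (h (\<iota> i)))" if W: "W \<in> S" for W
    proof (cases "m = 0")
      case True
      then show ?thesis
        using D' by (intro exI[of _ 0] exI[of _ id]) (auto simp: quasi_chain_def)
    next
      case m: False
      have "\<exists>w. i \<le> m \<longrightarrow> w \<in> Q W \<and> d W (e W (h i)) w \<le> c" for i
        using hH W unfolding rail_hull_def by blast
      then obtain w where w: "\<And>i. i \<le> m \<Longrightarrow> w i \<in> Q W" "\<And>i. i \<le> m \<Longrightarrow> d W (e W (h i)) (w i) \<le> c"
        by metis
      \<comment> \<open>The coarse coordinate on the rail: \<open>a_le\<close> and
        \<open>le_a\<close> compare it with the distance.\<close>
      define a where "a i = d W (e W x) (w i)" for i
      have c: "0 \<le> c" using w(2)[of 0] d_nonneg order_trans by blast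
      have close: "\<bar>d W (e W (h i)) (e W (h j)) - d W (w i) (w j)\<bar> \<le> 2 * c" if "i \<le> m" "j \<le> m" for i j
        using w(2)[OF that(1)] w(2)[OF that(2)] sym[of W "w i" "e W (h i)"] sym[of W "w j" "e W (h j)"]
          tri[of W "e W (h i)" "e W (h j)" "w i"] tri[of W "w i" "e W (h j)" "w j"]
          tri[of W "w i" "w j" "e W (h i)"] tri[of W "e W (h i)" "w j" "e W (h j)"] by linarith
      have a_le: "\<bar>a i - a j\<bar> \<le> d W (w i) (w j)" for i j
        using tri[of W "e W x" "w i" "w j"] tri[of W "e W x" "w j" "w i"] sym[of W "w i" "w j"]
        unfolding a_def by linarith
      have le_a: "d W (w i) (w j) \<le> \<bar>a i - a j\<bar> + (10 * k + 2)" if "i \<le> m" "j \<le> m" for i j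
        using rail[OF W] w(1)[OF that(1)] w(1)[OF that(2)] unfolding rail_def a_def by blast
      have jump: "\<bar>a (Suc i) - a i\<bar> \<le> J" if i: "i < m" for i
      proof -
        have "k * dX (h i) (h (Suc i)) \<le> k * D" using h(3)[OF i] k by (intro mult_left_mono) auto
        then show ?thesis
          using lipschitz[OF W, of "h i" "h (Suc i)"] close[of i "Suc i"] a_le[of i "Suc i"] i c
          unfolding J_def by auto
      qed
      have "a 0 \<le> J"
        using w(2)[of 0] h(1) c k kD by (simp add: a_def J_def)
      then obtain K \<iota> where \<iota>: "\<iota> 0 = 0" "\<iota> K = m" "\<forall>i<K. \<iota> i < \<iota> (Suc i)"
          "\<And>i. i \<le> K \<Longrightarrow> \<bar>a (\<iota> i) - 2 * J * real i\<bar> \<le> 2 * J"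
        using last_exit_indices[of m J a] m J jump by (auto simp: a_def)
      have \<iota>_le: "\<iota> i \<le> m" if "i \<le> K" for i
        using that
      proof (induction "K - i" arbitrary: i)
        case (Suc j)
        then have "\<iota> (Suc i) \<le> m" by auto
        moreover have "\<iota> i < \<iota> (Suc i)" using \<iota>(3) Suc by auto
        ultimately show ?case by linarith
      qed (use \<iota>(2) in simp)
      have "\<bar>real i - real j\<bar> / D' - D' \<le> d W (e W (h (\<iota> i))) (e W (h (\<iota> j))) \<and>
          d W (e W (h (\<iota> i))) (e W (h (\<iota> j))) \<le> D' * \<bar>real i - real j\<bar> + D'"
        if ij: "i \<le> K" "j \<le> K" for i j
      proof -
        let ?\<Delta> = "\<bar>real i - real j\<bar>"
        have "\<bar>2 * J * real i - 2 * J * real j\<bar> = 2 * J * ?\<Delta>"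
          using J by (simp add: abs_mult flip: right_diff_distrib)
        then have "\<bar>d W (e W (h (\<iota> i))) (e W (h (\<iota> j))) - 2 * J * ?\<Delta>\<bar> \<le> Z"
          using \<iota>(4)[OF ij(1)] \<iota>(4)[OF ij(2)] close[OF \<iota>_le \<iota>_le, OF ij] a_le[of "\<iota> i" "\<iota> j"]
            le_a[OF \<iota>_le \<iota>_le, OF ij] c unfolding Z_def by linarith
        moreover have "2 * J * ?\<Delta> \<le> D' * ?\<Delta>" using D' by (intro mult_right_mono) auto
        moreover have "?\<Delta> / D' \<le> ?\<Delta> / 1" using D' by (intro divide_left_mono) auto
        moreover have "1 * ?\<Delta> \<le> 2 * J * ?\<Delta>" using J by (intro mult_right_mono) auto
        ultimately show ?thesis using D' by linarith
      qed
      then show ?thesis using \<iota>(1-3) unfolding quasi_chain_def by blast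
    qed
    ultimately show ?thesis using h(1,2) by blast
  qed
  then show ?thesis using D'(5) by blast
qed

end

subsection \<open>Chains and quasigeodesics in metric spaces\<close>

lemma set_dist_le:
  assumes "a \<in> A" "b \<in> B"
  shows "set_dist m A B \<le> mdist m a b"
proof -
  have "bdd_below ((\<lambda>(a, b). mdist m a b) ` (A \<times> B))"
    by (intro bdd_belowI[of _ 0]) auto
  from cINF_lower[OF this, of "(a, b)"] show ?thesis
    using assms by (simp add: set_dist_def)
qed

lemma mdist_le_set_dist:
  assumes A: "diam_le m A r" "A \<subseteq> mspace m" and B: "diam_le m B r'" "B \<subseteq> mspace m"
    and ab: "a \<in> A" "b \<in> B"
  shows "mdist m a b \<le> set_dist m A B + r + r'"
proof -
  have "mdist m a b - r - r' \<le> mdist m a' b'" if "a' \<in> A" "b' \<in> B" for a' b'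
  proof -
    have "mdist m a a' \<le> r" "mdist m b' b \<le> r'" using A B ab that by (auto simp: diam_le_def)
    moreover have "mdist m a b \<le> mdist m a a' + mdist m a' b" "mdist m a' b \<le> mdist m a' b' + mdist m b' b"
      using A B ab that by (auto intro!: mdist_triangle)
    ultimately show ?thesis by linarith
  qed
  then have "mdist m a b - r - r' \<le> set_dist m A B"
    unfolding set_dist_def using ab by (intro cINF_greatest) auto
  then show ?thesis by linarith
qed

lemma diam_le_singleton: "a \<in> mspace m \<Longrightarrow> diam_le m {a} 0"
  unfolding diam_le_def by (metis mdist_zero order_refl singletonD)

section \<open>Geodesic segments and metric intervals\<close>

lemma geodesic_segmentE:
  assumes "geodesic_segment m x y G"
  obtains \<gamma> where "\<gamma> ` {0..mdist m x y} \<subseteq> mspace m" "\<gamma> 0 = x" "\<gamma> (mdist m x y) = y"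
    "G = \<gamma> ` {0..mdist m x y}"
    "\<And>s t. s \<in> {0..mdist m x y} \<Longrightarrow> t \<in> {0..mdist m x y} \<Longrightarrow> mdist m (\<gamma> s) (\<gamma> t) = \<bar>s - t\<bar>"
proof -
  obtain \<gamma> l where g: "0 \<le> l" "\<gamma> ` {0..l} \<subseteq> mspace m"
      "\<forall>s\<in>{0..l}. \<forall>t\<in>{0..l}. mdist m (\<gamma> s) (\<gamma> t) = \<bar>s - t\<bar>"
      "\<gamma> 0 = x" "\<gamma> l = y" "G = \<gamma> ` {0..l}"
    using assms unfolding geodesic_segment_def by blast
  then have "mdist m x y = l" by (metis abs_of_nonneg abs_minus_commute atLeastAtMost_iff diff_zero order_refl)
  then show ?thesis using that g by blast
qed

lemma geodesic_segment_btw: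
  assumes "geodesic_segment m x y G" "z \<in> G"
  shows "z \<in> mspace m" "btw (mdist m) x z y"
proof -
  obtain \<gamma> where g: "\<gamma> ` {0..mdist m x y} \<subseteq> mspace m" "\<gamma> 0 = x" "\<gamma> (mdist m x y) = y"
    "G = \<gamma> ` {0..mdist m x y}"
    "\<And>s t. s \<in> {0..mdist m x y} \<Longrightarrow> t \<in> {0..mdist m x y} \<Longrightarrow> mdist m (\<gamma> s) (\<gamma> t) = \<bar>s - t\<bar>"
    using geodesic_segmentE[OF assms(1)] by blast
  show "z \<in> mspace m" using g assms(2) by blast
  obtain t where t: "t \<in> {0..mdist m x y}" "z = \<gamma> t" using assms(2) g(4) by blast
  have "mdist m (\<gamma> 0) z = t" "mdist m z (\<gamma> (mdist m x y)) = mdist m x y - t"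
    using g(5)[of 0 t] g(5)[of t "mdist m x y"] t by auto
  then show "btw (mdist m) x z y" using g(2,3) by (simp add: btw_def)
qed

text \<open>Concatenate geodesics from \<open>a\<close> to \<open>u\<close> and from
  \<open>u\<close> to \<open>b\<close>. Their lengths add up to the distance of \<open>a\<close> and
  \<open>b\<close>, so no triangle inequality along the way can be strict.\<close>

lemma geodesic_through:
  assumes geo: "geodesic_metric m" and M: "a \<in> mspace m" "u \<in> mspace m" "b \<in> mspace m"
    and u: "btw (mdist m) a u b"
  shows "\<exists>G. geodesic_segment m a b G \<and> u \<in> G"
proof -
  let ?l = "mdist m a u" and ?l' = "mdist m u b"
  obtain G where G: "geodesic_segment m a u G" using geo M unfolding geodesic_metric_def by blast
  obtain f where f: "f ` {0..?l} \<subseteq> mspace m" "f 0 = a" "f ?l = u" "G = f ` {0..?l}"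
    "\<And>s t. s \<in> {0..?l} \<Longrightarrow> t \<in> {0..?l} \<Longrightarrow> mdist m (f s) (f t) = \<bar>s - t\<bar>"
    by (rule geodesic_segmentE[OF G]) (rule that)
  obtain G' where G': "geodesic_segment m u b G'" using geo M unfolding geodesic_metric_def by blast
  obtain g where g: "g ` {0..?l'} \<subseteq> mspace m" "g 0 = u" "g ?l' = b" "G' = g ` {0..?l'}"
    "\<And>s t. s \<in> {0..?l'} \<Longrightarrow> t \<in> {0..?l'} \<Longrightarrow> mdist m (g s) (g t) = \<bar>s - t\<bar>"
    by (rule geodesic_segmentE[OF G']) (rule that)
  define h where "h t = (if t \<le> ?l then f t else g (t - ?l))" for t
  have h: "h t = g (t - ?l)" if "?l \<le> t" for t using that f(3) g(2) by (auto simp: h_def)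
  have hM: "h ` {0..?l + ?l'} \<subseteq> mspace m"
    using f(1) g(1) by (force simp: h_def image_subset_iff)
  have mixed: "mdist m (h s) (h t) = t - s" if s: "0 \<le> s" "s \<le> ?l" and t: "?l \<le> t" "t \<le> ?l + ?l'" for s t
  proof -
    have hs: "h s = f s" "h t = g (t - ?l)" using s t h by (auto simp: h_def)
    have m: "f s \<in> mspace m" "g (t - ?l) \<in> mspace m" using f(1) g(1) s t by (auto simp: image_subset_iff)
    have "mdist m (f s) u = ?l - s" "mdist m a (f s) = s"
      using f(5)[of s ?l] f(5)[of 0 s] f(2,3) s by auto
    moreover have "mdist m u (g (t - ?l)) = t - ?l" "mdist m (g (t - ?l)) b = ?l + ?l' - t"
      using g(5)[of 0 "t - ?l"] g(5)[of "t - ?l" ?l'] g(2,3) t by auto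
    moreover have "mdist m (f s) (g (t - ?l)) \<le> mdist m (f s) u + mdist m u (g (t - ?l))"
      "mdist m a b \<le> mdist m a (f s) + mdist m (f s) b"
      "mdist m (f s) b \<le> mdist m (f s) (g (t - ?l)) + mdist m (g (t - ?l)) b"
      using M m by (auto intro!: mdist_triangle)
    ultimately show ?thesis using u unfolding hs btw_def by linarith
  qed
  have "mdist m (h s) (h t) = \<bar>s - t\<bar>" if st: "s \<in> {0..?l + ?l'}" "t \<in> {0..?l + ?l'}" for s t
  proof -
    consider "s \<le> ?l" "t \<le> ?l" | "s \<le> ?l" "?l \<le> t" | "?l \<le> s" "t \<le> ?l" | "?l \<le> s" "?l \<le> t"
      by linarith
    then show ?thesis
    proof cases
      case 1
      then show ?thesis using f(5)[of s t] st by (simp add: h_def)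
    next
      case 2
      then show ?thesis using mixed[of s t] st by auto
    next
      case 3
      then show ?thesis using mixed[of t s] st by (auto simp: mdist_commute)
    next
      case 4
      then show ?thesis using g(5)[of "s - ?l" "t - ?l"] st by (auto simp: h)
    qed
  qed
  moreover have "h 0 = a" "h (?l + ?l') = b" "h ?l = u"
    using f(2,3) g(3) h[of "?l + ?l'"] by (auto simp: h_def)
  moreover have "h ?l \<in> h ` {0..?l + ?l'}" by (rule imageI) simp
  ultimately have "geodesic_segment m a b (h ` {0..?l + ?l'})" "u \<in> h ` {0..?l + ?l'}"
    using hM unfolding geodesic_segment_def by (intro exI[of _ h] exI[of _ "?l + ?l'"], auto)
  then show ?thesis by blast
qed

text \<open>Coarse maps may jump, so a step function suffices. Rounding changes a parameter
  difference by at most 1, and passing from points to sets changes a distance by at most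
  \<open>2 * r\<close>; \<open>B\<close> absorbs both.\<close>

lemma quasigeodesic_floor:
  assumes D: "1 \<le> D" and A: "\<And>i. i \<le> n \<Longrightarrow> A i \<subseteq> mspace m \<and> diam_le m (A i) r \<and> p i \<in> A i"
    and p: "quasi_chain D (mdist m) n p" and B: "2 * D + 2 * r + 1 \<le> B"
  shows "quasigeodesic B m (real n) (\<lambda>t. A (nat \<lfloor>t\<rfloor>))"
proof -
  have "mdist m (p 0) (p 0) \<le> r" using A[of 0] by (auto simp: diam_le_def)
  then have r: "0 \<le> r" by (meson mdist_nonneg order_trans)
  have n: "nat \<lfloor>t\<rfloor> \<le> n" "t - 1 < real (nat \<lfloor>t\<rfloor>)" "real (nat \<lfloor>t\<rfloor>) \<le> t" if "t \<in> {0..real n}" for t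
    using that by (auto simp: nat_le_iff floor_le_iff)
  have "coarse_map B {0..real n} m (\<lambda>t. A (nat \<lfloor>t\<rfloor>))"
    unfolding coarse_map_def
  proof (intro ballI)
    fix t assume "t \<in> {0..real n}"
    then have "nat \<lfloor>t\<rfloor> \<le> n" by (rule n)
    from A[OF this] show "A (nat \<lfloor>t\<rfloor>) \<noteq> {} \<and> A (nat \<lfloor>t\<rfloor>) \<subseteq> mspace m \<and> diam_le m (A (nat \<lfloor>t\<rfloor>)) B"
      using B D r unfolding diam_le_def by fastforce
  qed
  moreover have "1 / B * \<bar>s - t\<bar> - B \<le> set_dist m (A (nat \<lfloor>s\<rfloor>)) (A (nat \<lfloor>t\<rfloor>)) \<and>
      set_dist m (A (nat \<lfloor>s\<rfloor>)) (A (nat \<lfloor>t\<rfloor>)) \<le> B * \<bar>s - t\<bar> + B"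
    if st: "s \<in> {0..real n}" "t \<in> {0..real n}" for s t
  proof -
    let ?i = "nat \<lfloor>s\<rfloor>" and ?j = "nat \<lfloor>t\<rfloor>"
    let ?\<Delta> = "\<bar>real ?i - real ?j\<bar>"
    note i = n[OF st(1)] and j = n[OF st(2)]
    have up: "set_dist m (A ?i) (A ?j) \<le> mdist m (p ?i) (p ?j)"
      using A[OF i(1)] A[OF j(1)] by (intro set_dist_le) auto
    have low: "mdist m (p ?i) (p ?j) \<le> set_dist m (A ?i) (A ?j) + r + r"
      using A[OF i(1)] A[OF j(1)] by (intro mdist_le_set_dist) auto
    have pq: "?\<Delta> / D - D \<le> mdist m (p ?i) (p ?j)" "mdist m (p ?i) (p ?j) \<le> D * ?\<Delta> + D"
      using p i j unfolding quasi_chain_def by blast+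
    have \<Delta>: "\<bar>s - t\<bar> \<le> ?\<Delta> + 1" "?\<Delta> \<le> \<bar>s - t\<bar> + 1" using i j by linarith+
    have "D * ?\<Delta> \<le> D * (\<bar>s - t\<bar> + 1)" using \<Delta> D by (intro mult_left_mono) auto
    also have "\<dots> \<le> B * \<bar>s - t\<bar> + D"
      using mult_right_mono[of D B "\<bar>s - t\<bar>"] B D r by (simp add: distrib_left)
    finally have 1: "set_dist m (A ?i) (A ?j) \<le> B * \<bar>s - t\<bar> + B" using up pq(2) B D r by linarith
    have "1 / B * \<bar>s - t\<bar> \<le> 1 / D * \<bar>s - t\<bar>"
      using B D r by (intro mult_right_mono) (auto simp: frac_le)
    also have "\<dots> \<le> 1 / D * (?\<Delta> + 1)" using \<Delta> D by (intro mult_left_mono) auto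
    also have "\<dots> \<le> ?\<Delta> / D + 1" using D by (simp add: field_simps)
    finally have "1 / B * \<bar>s - t\<bar> - B \<le> set_dist m (A ?i) (A ?j)" using low pq(1) B D r by linarith
    with 1 show ?thesis by blast
  qed
  ultimately show ?thesis
    using B D r unfolding quasigeodesic_def by auto
qed

lemma unparam_quasigeodesic_floor:
  assumes D: "1 \<le> D" and A: "\<And>i. i \<le> n \<Longrightarrow> A i \<subseteq> mspace m \<and> diam_le m (A i) r \<and> p i \<in> A i"
    and \<iota>: "\<iota> 0 = 0" "\<iota> K = n" "\<And>i. i < K \<Longrightarrow> \<iota> i < \<iota> (Suc i)"
    and p: "quasi_chain D (mdist m) K (\<lambda>i. p (\<iota> i))" and B: "2 * D + 2 * r + 1 \<le> B"
  shows "unparam_quasigeodesic B m (real n) (\<lambda>t. A (nat \<lfloor>t\<rfloor>))"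
proof -
  have "mdist m (p 0) (p 0) \<le> r" using A[of 0] by (auto simp: diam_le_def)
  then have r: "0 \<le> r" by (meson mdist_nonneg order_trans)
  have less: "\<iota> i < \<iota> j" if "i < j" "j \<le> K" for i j
    using that
  proof (induction j)
    case (Suc j)
    then show ?case using \<iota>(3)[of j] by (cases "i = j") auto
  qed simp
  have \<iota>_le: "\<iota> i \<le> n" if "i \<le> K" for i
    using less[of i K] \<iota>(2) that by (cases "i = K") auto
  \<comment> \<open>The fractional term makes \<open>g\<close> strictly increasing between integers
    while leaving its integer part, and hence the step function, unchanged.\<close>
  define g where "g t = real (\<iota> (nat \<lfloor>t\<rfloor>)) + frac t / 2" for t
  have floor_g: "nat \<lfloor>g t\<rfloor> = \<iota> (nat \<lfloor>t\<rfloor>)" for t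
  proof -
    have "\<lfloor>g t\<rfloor> = int (\<iota> (nat \<lfloor>t\<rfloor>))"
      unfolding g_def using frac_ge_0[of t] frac_lt_1[of t] by (intro floor_unique) auto
    then show ?thesis by simp
  qed
  have nK: "nat \<lfloor>t\<rfloor> \<le> K" if "t \<in> {0..real K}" for t
    using that by (simp add: nat_le_iff floor_le_iff)
  have mono: "strict_mono_on {0..real K} g"
  proof (rule strict_mono_onI)
    fix s t assume st: "s \<in> {0..real K}" "t \<in> {0..real K}" "s < t"
    show "g s < g t"
    proof (cases "\<lfloor>s\<rfloor> = \<lfloor>t\<rfloor>")
      case True
      then show ?thesis using st by (simp add: g_def frac_def)
    next
      case False
      then have "\<lfloor>s\<rfloor> < \<lfloor>t\<rfloor>" "0 \<le> \<lfloor>s\<rfloor>" using st floor_mono[of s t] by auto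
      then have "nat \<lfloor>s\<rfloor> < nat \<lfloor>t\<rfloor>" by linarith
      then have "\<iota> (nat \<lfloor>s\<rfloor>) < \<iota> (nat \<lfloor>t\<rfloor>)" using less[OF _ nK[OF st(2)]] by blast
      then have "real (\<iota> (nat \<lfloor>s\<rfloor>)) + 1 \<le> real (\<iota> (nat \<lfloor>t\<rfloor>))" by linarith
      then show ?thesis using frac_lt_1[of s] frac_ge_0[of t] unfolding g_def by linarith
    qed
  qed
  have g0K: "g 0 = 0" "g (real K) = real n" using \<iota> by (auto simp: g_def)
  have "g t \<in> {0..real n}" if t: "t \<in> {0..real K}" for t
  proof -
    have "g t \<le> g (real K)"
      using strict_mono_onD[OF mono t, of "real K"] t by (cases "t = real K") auto
    then show ?thesis using g0K by (simp add: g_def)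
  qed
  then have range: "g ` {0..real K} \<subseteq> {0..real n}" by blast
  have "quasigeodesic B m (real K) (\<lambda>t. A (\<iota> (nat \<lfloor>t\<rfloor>)))"
    using A \<iota>_le by (intro quasigeodesic_floor[OF D _ p B, of "\<lambda>i. A (\<iota> i)"]) auto
  then have qg: "quasigeodesic B m (real K) ((\<lambda>t. A (nat \<lfloor>t\<rfloor>)) \<circ> g)"
    by (simp add: o_def floor_g)
  have jump: "diam_le m (A (nat \<lfloor>g (real j)\<rfloor>) \<union> A (nat \<lfloor>g (real j + 1)\<rfloor>)) B"
    if j: "real j + 1 \<le> real K" for j
  proof -
    have eq: "nat \<lfloor>g (real j)\<rfloor> = \<iota> j" "nat \<lfloor>g (real j + 1)\<rfloor> = \<iota> (Suc j)"
      unfolding floor_g by (auto simp: nat_add_distrib)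
    have jK: "j \<le> K" "Suc j \<le> K" using j by linarith+
    let ?A = "A (\<iota> j)" and ?B = "A (\<iota> (Suc j))"
    have AB: "?A \<subseteq> mspace m" "diam_le m ?A r" "?B \<subseteq> mspace m" "diam_le m ?B r"
        "p (\<iota> j) \<in> ?A" "p (\<iota> (Suc j)) \<in> ?B"
      using A[OF \<iota>_le] jK by blast+
    have "mdist m (p (\<iota> j)) (p (\<iota> (Suc j))) \<le> D * \<bar>real j - real (Suc j)\<bar> + D"
      using p jK unfolding quasi_chain_def by blast
    then have pp: "mdist m (p (\<iota> j)) (p (\<iota> (Suc j))) \<le> 2 * D" by simp
    have *: "mdist m a b \<le> B" if "a \<in> ?A" "b \<in> ?B" for a b
      using mdist_le_set_dist[OF AB(2,1,4,3) that] set_dist_le[OF AB(5,6), of m] pp B by linarith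
    have "r \<le> B" using B D r by linarith
    then show ?thesis
      unfolding eq diam_le_def using * AB(2,4) mdist_commute[of m]
      by (metis (no_types, lifting) UnE diam_le_def order_trans)
  qed
  have "coarse_map B {0..real n} m (\<lambda>t. A (nat \<lfloor>t\<rfloor>))"
    unfolding coarse_map_def
  proof (intro ballI)
    fix t assume "t \<in> {0..real n}"
    then have "nat \<lfloor>t\<rfloor> \<le> n" by (simp add: nat_le_iff floor_le_iff)
    from A[OF this] show "A (nat \<lfloor>t\<rfloor>) \<noteq> {} \<and> A (nat \<lfloor>t\<rfloor>) \<subseteq> mspace m \<and> diam_le m (A (nat \<lfloor>t\<rfloor>)) B"
      using B D r unfolding diam_le_def by fastforce
  qed
  then show ?thesis
    unfolding unparam_quasigeodesic_def
    using mono range g0K qg jump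
    by (intro conjI exI[of _ "real K"] exI[of _ g]) auto
qed

lemma quasigeodesic_chain:
  assumes f: "quasigeodesic q m l f" "joins l f x y"
  shows "\<exists>(n::nat) c. c 0 = x \<and> c n = y \<and> real n \<le> q * mdist m x y + q * q + 1 \<and>
     (\<forall>i\<le>n. c i \<in> mspace m) \<and> (\<forall>i<n. mdist m (c i) (c (Suc i)) \<le> 4 * q)"
proof -
  have q: "1 \<le> q" "0 \<le> l" using f by (auto simp: quasigeodesic_def)
  have fI: "f t \<noteq> {}" "f t \<subseteq> mspace m" "diam_le m (f t) q" if "t \<in> {0..l}" for t
    using f that unfolding quasigeodesic_def coarse_map_def by blast+
  have fd: "\<bar>s - t\<bar> / q - q \<le> set_dist m (f s) (f t)" "set_dist m (f s) (f t) \<le> q * \<bar>s - t\<bar> + q"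
    if "s \<in> {0..l}" "t \<in> {0..l}" for s t
    using f that unfolding quasigeodesic_def by auto
  \<comment> \<open>One more than the integer part, so that \<open>u n = l\<close> and the two ends
    have different indices even if \<open>l = 0\<close>.\<close>
  define n where "n = nat \<lfloor>l\<rfloor> + 1"
  have n: "l < real n" "real n \<le> l + 1" using q unfolding n_def by linarith+
  define u where "u i = min (real i) l" for i
  have u: "u i \<in> {0..l}" for i using q by (auto simp: u_def)
  define c where "c i = (if i = 0 then x else if i = n then y else SOME p. p \<in> f (u i))" for i
  have c: "c i \<in> f (u i)" for i
  proof -
    have "x \<in> f (u 0)" "y \<in> f (u n)" using f(2) n q by (auto simp: u_def joins_def min_def)
    moreover have "(SOME p. p \<in> f (u i)) \<in> f (u i)" using fI(1)[OF u] by (simp add: some_in_eq)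
    ultimately show ?thesis by (auto simp: c_def)
  qed
  have "mdist m (c i) (c (Suc i)) \<le> 4 * q" for i
  proof -
    have "mdist m (c i) (c (Suc i)) \<le> set_dist m (f (u i)) (f (u (Suc i))) + q + q"
      using fI[OF u] c by (intro mdist_le_set_dist) auto
    moreover have "\<bar>u i - u (Suc i)\<bar> \<le> 1" by (auto simp: u_def min_def)
    then have "q * \<bar>u i - u (Suc i)\<bar> \<le> q * 1" using q by (intro mult_left_mono) auto
    ultimately show ?thesis using fd(2)[OF u u, of i "Suc i"] by linarith
  qed
  moreover have "l / q - q \<le> mdist m x y"
    using fd(1)[of 0 l] set_dist_le[of x "f 0" y "f l" m] f(2) q by (auto simp: joins_def)
  then have "l \<le> q * mdist m x y + q * q" using q by (simp add: field_simps)
  moreover have "c i \<in> mspace m" for i using c fI(2)[OF u] by blast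
  ultimately show ?thesis
    using n by (intro exI[of _ n] exI[of _ c]) (auto simp: c_def n_def)
qed

subsection \<open>Hierarchical spaces as coarse hierarchies\<close>

text \<open>The rank of \<open>W\<close> is the largest size of a chain strictly below it; a chain
  strictly below \<open>V\<close>, with \<open>V\<close> added, is a longer chain strictly below
  \<open>W\<close>.\<close>

lemma (in hierarchical_space) ex_rank:
  "\<exists>rk (n::nat). (\<forall>V\<in>S. rk V \<le> n) \<and> (\<forall>V\<in>S. \<forall>W\<in>S. V \<sqsubset> W \<longrightarrow> rk V < rk W)"
proof -
  define chain where "chain A \<longleftrightarrow> (\<forall>V\<in>A. \<forall>W\<in>A. V \<sqsubseteq> W \<or> W \<sqsubseteq> V)" for A
  obtain n where n: "\<And>A. A \<subseteq> S \<Longrightarrow> chain A \<Longrightarrow> finite A \<and> card A \<le> n"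
    using finite_complexity unfolding chain_def by blast
  define cs where "cs W = card ` {A. A \<subseteq> {V\<in>S. V \<sqsubset> W} \<and> chain A}" for W
  define rk where "rk W = Max (cs W)" for W
  have cs_le: "cs W \<subseteq> {..n}" for W
    using n unfolding cs_def by blast
  then have fin: "finite (cs W)" for W using finite_subset by blast
  have ne: "cs W \<noteq> {}" for W
    unfolding cs_def chain_def by blast
  have "rk V \<le> n" for V
    using Max_in[OF fin ne] cs_le unfolding rk_def by blast
  moreover have "rk V < rk W" if VW: "V \<in> S" "W \<in> S" "V \<sqsubset> W" for V W
  proof -
    obtain A where A: "A \<subseteq> {U\<in>S. U \<sqsubset> V}" "chain A" "rk V = card A"
      using Max_in[OF fin ne, of V] unfolding rk_def cs_def by blast
    have "V \<sqsubseteq> V" using nested_refl VW(1) by (auto dest: reflp_onD)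
    then have "chain (insert V A)"
      using A unfolding chain_def pnested_def by blast
    moreover have "U \<sqsubset> W" if "U \<in> S" "U \<sqsubset> V" for U
      using that VW transp_onD[OF nested_trans, of U V W] antisymp_onD[OF nested_antisym, of U V]
      unfolding pnested_def by blast
    then have "insert V A \<subseteq> {U\<in>S. U \<sqsubset> W}" using A(1) VW by blast
    ultimately have "card (insert V A) \<in> cs W" unfolding cs_def by blast
    then have "card (insert V A) \<le> rk W" unfolding rk_def using fin by simp
    moreover have "V \<notin> A" using A(1) unfolding pnested_def by blast
    moreover have "finite A" using n[of A] A by blast
    ultimately show ?thesis using A(3) by simp
  qed
  ultimately show ?thesis by blast
qed

text \<open>A unique maximal element is greatest, because bounded rank lets every element climb to a
  maximal one.\<close>

lemma (in hierarchical_space) ex_top: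
  assumes "S \<noteq> {}"
  shows "\<exists>M\<in>S. \<forall>V\<in>S. V \<sqsubseteq> M"
proof -
  obtain rk and n :: nat where rk: "\<And>V. V \<in> S \<Longrightarrow> rk V \<le> n"
      "\<And>V W. V \<in> S \<Longrightarrow> W \<in> S \<Longrightarrow> V \<sqsubset> W \<Longrightarrow> rk V < rk W"
    using ex_rank by blast
  have "\<exists>!M. M \<in> S \<and> (\<forall>W\<in>S. M \<sqsubseteq> W \<longrightarrow> W = M)"
    using nested_max assms by (elim disjE) simp_all
  then obtain M where M: "M \<in> S" "\<And>V. V \<in> S \<Longrightarrow> \<forall>W\<in>S. V \<sqsubseteq> W \<longrightarrow> W = V \<Longrightarrow> V = M"
    by (elim ex1E) (rule that, blast+)
  have "V \<sqsubseteq> M" if "V \<in> S" for V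
    using that
  proof (induction "n - rk V" arbitrary: V rule: less_induct)
    case less
    show ?case
    proof (cases "\<forall>W\<in>S. V \<sqsubseteq> W \<longrightarrow> W = V")
      case True
      then have "V = M" using M(2) less.prems by blast
      then show ?thesis using nested_refl less.prems by (auto dest: reflp_onD)
    next
      case False
      then obtain W where W: "W \<in> S" "V \<sqsubseteq> W" "W \<noteq> V" by blast
      then have "rk V < rk W" "rk W \<le> n" using rk less.prems by (auto simp: pnested_def)
      then have "W \<sqsubseteq> M" using less.hyps[of W] W by linarith
      then show ?thesis using transp_onD[OF nested_trans] less.prems W M(1) by blast
    qed
  qed
  then show ?thesis using M(1) by blast
qed

text \<open>Totalised point versions of the coordinates, projections and distances, so that no
  membership side conditions remain.\<close>

locale pointed_hierarchical_space = hierarchical_space +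
  fixes x0 :: 'a and \<delta> :: real
  assumes x0: "x0 \<in> mspace X"
    and minimal_or_hyperbolic: "\<And>W. W \<in> S \<Longrightarrow> minimal W \<or> hyperbolic \<delta> (C W)"
begin

definition rx :: "'a \<Rightarrow> 'a" where
  "rx x = (if x \<in> mspace X then x else x0)"

definition ret :: "'b \<Rightarrow> 'c \<Rightarrow> 'c" where
  "ret W p = (if p \<in> mspace (C W) then p else SOME p. p \<in> mspace (C W))"

definition pt :: "'b \<Rightarrow> 'a \<Rightarrow> 'c" where
  "pt W x = (SOME p. p \<in> \<pi> W (rx x))"

definition pt_rho :: "'b \<Rightarrow> 'b \<Rightarrow> 'c" where
  "pt_rho V W = (SOME p. p \<in> \<rho> V W)"

definition pt_sigma :: "'b \<Rightarrow> 'b \<Rightarrow> 'c \<Rightarrow> 'c" where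
  "pt_sigma W V p = (SOME q. q \<in> \<sigma> W V (ret W p))"

text \<open>The value 0 outside \<open>S\<close> makes this a geodesic pseudometric for every
  index.\<close>

definition dist_at :: "'b \<Rightarrow> 'c \<Rightarrow> 'c \<Rightarrow> real" where
  "dist_at W a b = (if W \<in> S then mdist (C W) (ret W a) (ret W b) else 0)"

lemma rx_in [simp]: "rx x \<in> mspace X"
  using x0 by (simp add: rx_def)

lemma rx_id [simp]: "x \<in> mspace X \<Longrightarrow> rx x = x"
  by (simp add: rx_def)

lemma proj:
  assumes "W \<in> S"
  shows "pt W x \<in> \<pi> W (rx x)" "\<pi> W (rx x) \<subseteq> mspace (C W)" "diam_le (C W) (\<pi> W (rx x)) \<xi>"
  using proj_coarse[OF assms] unfolding coarse_map_def pt_def by (auto simp: some_in_eq)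

lemma pt_in [simp]: "W \<in> S \<Longrightarrow> pt W x \<in> mspace (C W)"
  using proj by blast

lemma ret_id [simp]: "p \<in> mspace (C W) \<Longrightarrow> ret W p = p"
  by (simp add: ret_def)

lemma ret_in [simp]:
  assumes "W \<in> S"
  shows "ret W p \<in> mspace (C W)"
proof -
  have "mspace (C W) \<noteq> {}" using pt_in[OF assms] by blast
  then show ?thesis by (simp add: ret_def some_in_eq)
qed

lemma pt_rho:
  assumes "V \<in> S" "W \<in> S" "V \<sqsubset> W \<or> transverse V W"
  shows "pt_rho V W \<in> \<rho> V W" "\<rho> V W \<subseteq> mspace (C W)" "diam_le (C W) (\<rho> V W) \<xi>"
  using nested_\<rho>[OF assms(1,2)] transverse_\<rho>[OF assms(1,2)] assms(3)
  unfolding pt_rho_def by (auto simp: some_in_eq)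

lemma pt_sigma:
  assumes "V \<in> S" "W \<in> S" "V \<sqsubset> W"
  shows "pt_sigma W V p \<in> \<sigma> W V (ret W p)" "\<sigma> W V (ret W p) \<subseteq> mspace (C V)"
  using nested_\<sigma>[OF assms, of "ret W p"] assms unfolding pt_sigma_def by (auto simp: some_in_eq)

lemma dist_at: "W \<in> S \<Longrightarrow> a \<in> mspace (C W) \<Longrightarrow> b \<in> mspace (C W) \<Longrightarrow> dist_at W a b = mdist (C W) a b"
  by (simp add: dist_at_def)

lemma geodesic_pseudometric_dist_at: "geodesic_pseudometric (dist_at W)"
proof (cases "W \<in> S")
  case W: True
  show ?thesis
  proof
    fix a b c
    show "dist_at W a a = 0" "dist_at W a b = dist_at W b a"
      "dist_at W a c \<le> dist_at W a b + dist_at W b c"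
      using W by (auto simp: dist_at_def mdist_commute intro!: mdist_triangle)
    obtain G where G: "geodesic_segment (C W) (ret W a) (ret W b) G"
      using geodesic_C[OF W] W unfolding geodesic_metric_def by (meson ret_in)
    obtain \<gamma> where g: "\<gamma> ` {0..mdist (C W) (ret W a) (ret W b)} \<subseteq> mspace (C W)"
        "\<gamma> 0 = ret W a" "\<gamma> (mdist (C W) (ret W a) (ret W b)) = ret W b"
        "G = \<gamma> ` {0..mdist (C W) (ret W a) (ret W b)}"
        "\<And>s t. s \<in> {0..mdist (C W) (ret W a) (ret W b)} \<Longrightarrow>
          t \<in> {0..mdist (C W) (ret W a) (ret W b)} \<Longrightarrow> mdist (C W) (\<gamma> s) (\<gamma> t) = \<bar>s - t\<bar>"
      by (rule geodesic_segmentE[OF G]) (rule that)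
    have "dist_at W (\<gamma> s) (\<gamma> t) = \<bar>s - t\<bar>"
      if "s \<in> {0..dist_at W a b}" "t \<in> {0..dist_at W a b}" for s t
    proof -
      have "\<gamma> s \<in> mspace (C W)" "\<gamma> t \<in> mspace (C W)"
        using g(1) that W by (auto simp: dist_at_def image_subset_iff)
      then show ?thesis using g(5) that W by (simp add: dist_at_def)
    qed
    then show "\<exists>\<gamma>. dist_at W (\<gamma> 0) a = 0 \<and> dist_at W (\<gamma> (dist_at W a b)) b = 0 \<and>
        (\<forall>s\<in>{0..dist_at W a b}. \<forall>t\<in>{0..dist_at W a b}. dist_at W (\<gamma> s) (\<gamma> t) = \<bar>s - t\<bar>)"
      using g(2,3) W by (intro exI[of _ \<gamma>]) (auto simp: dist_at_def)
  qed
qed (unfold_locales, auto simp: dist_at_def)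

lemma dW_le: "W \<in> S \<Longrightarrow> dW W (rx x) (rx y) \<le> dist_at W (pt W x) (pt W y)"
  using set_dist_le[OF proj(1) proj(1)] by (simp add: dW_def dist_at)

lemma le_dW: "W \<in> S \<Longrightarrow> dist_at W (pt W x) (pt W y) \<le> dW W (rx x) (rx y) + 2 * \<xi>"
  using mdist_le_set_dist[OF proj(3,2) proj(3,2) proj(1) proj(1), of W x y]
  by (simp add: dW_def dist_at)

lemma le_dWset_rho:
  assumes "V \<in> S" "W \<in> S" "V \<sqsubset> W \<or> transverse V W"
  shows "dist_at W (pt W x) (pt_rho V W) \<le> dWset W (rx x) (\<rho> V W) + 2 * \<xi>"
  using mdist_le_set_dist[OF proj(3,2) pt_rho(3,2)[OF assms] proj(1) pt_rho(1)[OF assms], of x]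
    assms(2) pt_rho(1,2)[OF assms] by (simp add: dWset_def dist_at subset_iff)

text \<open>Choosing points in sets of diameter at most \<open>\<xi>\<close> changes a distance by
  at most \<open>2 * \<xi>\<close>; \<open>k\<close> dominates all constants of the axioms together
  with such losses.\<close>

lemma ex_coarse_hierarchy:
  "\<exists>k rk n. coarse_hierarchy S (\<sqsubseteq>) (\<bottom>) (\<lambda>x y. mdist X (rx x) (rx y)) dist_at pt pt_rho pt_sigma k rk n"
proof -
  obtain q where q: "quasigeodesic_metric q X" using quasigeodesic_X by blast
  then obtain l f where "quasigeodesic q X l f" using x0 unfolding quasigeodesic_metric_def by blast
  then have q1: "1 \<le> q" by (simp add: quasigeodesic_def)
  obtain K where K: "0 \<le> K" "\<And>W x y. W \<in> S \<Longrightarrow> x \<in> mspace X \<Longrightarrow> y \<in> mspace X \<Longrightarrow> dW W x y \<le> K * mdist X x y + K"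
      "\<And>W. W \<in> S \<Longrightarrow> quasiconvex K (C W) (image_proj W)"
    using projections by blast
  obtain \<Lambda> E1 where \<Lambda>: "1 \<le> \<Lambda>" and LL: "\<forall>W\<in>S. \<forall>x\<in>mspace X. \<forall>x'\<in>mspace X.
          (let N = \<Lambda> * dW W x x' + \<Lambda> in
             \<exists>\<T>\<subseteq>below W - {W}. finite \<T> \<and> int (card \<T>) \<le> \<lfloor>N\<rfloor> \<and>
               (\<forall>T\<in>below W - {W}. (\<exists>T'\<in>\<T>. T \<in> below T') \<or> dW T x x' < E1) \<and>
               (\<forall>T'\<in>\<T>. dWset W x (\<rho> T' W) \<le> N))"
    using large_links by blast
  have links: "\<exists>\<T>\<subseteq>below W - {W}. finite \<T> \<and> int (card \<T>) \<le> \<lfloor>\<Lambda> * dW W x x' + \<Lambda>\<rfloor> \<and>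
      (\<forall>T\<in>below W - {W}. (\<exists>T'\<in>\<T>. T \<in> below T') \<or> dW T x x' < E1)"
    if "W \<in> S" "x \<in> mspace X" "x' \<in> mspace X" for W x x'
    using LL[rule_format, OF that, unfolded Let_def] by blast
  obtain E2 where E2: "0 < E2" "\<And>V W a b G. V \<in> S \<Longrightarrow> W \<in> S \<Longrightarrow> V \<sqsubset> W \<Longrightarrow>
      geodesic_segment (C W) a b G \<Longrightarrow>
      diam_le (C V) (\<Union>p\<in>G. \<sigma> W V p) E2 \<or> G \<inter> nbhd (C W) E2 (\<rho> V W) \<noteq> {}"
    using bounded_geodesic_image by blast
  obtain \<alpha> where \<alpha>: "\<forall>F\<subseteq>S. \<forall>p. pairwise (\<bottom>) F \<longrightarrow>
          (\<forall>V\<in>F. p V \<in> image_proj V) \<longrightarrow>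
          (\<exists>x\<in>mspace X. (\<forall>V\<in>F. dWset V x {p V} \<le> \<alpha>) \<and>
             (\<forall>V\<in>F. \<forall>W\<in>S. V \<sqsubset> W \<or> transverse W V \<longrightarrow> dWset W x (\<rho> V W) \<le> \<alpha>))"
    by (rule exE[OF partial_realization])
  obtain rk n where rk: "\<forall>V\<in>S. rk V \<le> (n::nat)" "\<forall>V\<in>S. \<forall>W\<in>S. V \<sqsubset> W \<longrightarrow> rk V < rk W"
    using ex_rank by blast
  define k where "k = 1 + K + \<Lambda> + \<bar>E1\<bar> + E2 + \<bar>\<alpha>\<bar> + \<bar>\<delta>\<bar> + \<kappa>\<^sub>0 + 3 * \<xi> + 4 * q + q * q"
  have qq: "0 \<le> q * q" by simp
  have k: "1 \<le> k" "K + 2 * \<xi> \<le> k" "K \<le> k" "\<Lambda> \<le> k" "E1 + 2 * \<xi> \<le> k" "E2 \<le> k" "E2 + \<xi> \<le> k" "\<alpha> + 2 * \<xi> \<le> k"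
    "\<alpha> + \<xi> \<le> k" "\<delta> \<le> k" "\<kappa>\<^sub>0 + 2 * \<xi> \<le> k" "\<kappa>\<^sub>0 \<le> k" "K + \<xi> \<le> k" "4 * q \<le> k" "q \<le> k" "q * q + 2 \<le> k"
    unfolding k_def using K \<Lambda> E2(1) \<kappa>\<^sub>0_nonneg \<xi>_nonneg q1 qq by linarith+
  have sym: "V \<bottom> W \<longleftrightarrow> W \<bottom> V" if "V \<in> S" "W \<in> S" for V W
    using orth_sym that by (auto dest: symp_onD)
  have tr_sym: "transverse V W \<longleftrightarrow> transverse W V" if "V \<in> S" "W \<in> S" for V W
    using sym[OF that] unfolding transverse_def by blast
  have btw: "btw (dist_at W) a m b \<longleftrightarrow> btw (mdist (C W)) (ret W a) (ret W m) (ret W b)" if "W \<in> S" for W a m b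
    using that by (simp add: btw_def dist_at_def)
  have through: "\<exists>G. geodesic_segment (C W) (ret W a) (ret W b) G \<and> ret W m \<in> G"
    if "W \<in> S" "btw (dist_at W) a m b" for W a m b
    using geodesic_through[OF geodesic_C[OF that(1)]] that btw by simp
  have btw_seg: "btw (dist_at W) a z b" if "W \<in> S" "geodesic_segment (C W) (ret W a) (ret W b) G" "z \<in> G" for W a z b G
    using geodesic_segment_btw[OF that(2,3)] btw[OF that(1)] by simp
  show ?thesis
  proof (rule exI[of _ k], rule exI[of _ rk], rule exI[of _ n], rule coarse_hierarchy.intro)
    show "geodesic_pseudometric (dist_at W)" for W by (rule geodesic_pseudometric_dist_at)
    show "1 \<le> k" by (rule k)
    show "V \<sqsubseteq> V" if "V \<in> S" for V using nested_refl that by (auto dest: reflp_onD)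
    show "U \<sqsubseteq> W" if "U \<in> S" "V \<in> S" "W \<in> S" "U \<sqsubseteq> V" "V \<sqsubseteq> W" for U V W
      using transp_onD[OF nested_trans] that by blast
    show "V = W" if "V \<in> S" "W \<in> S" "V \<sqsubseteq> W" "W \<sqsubseteq> V" for V W
      using antisymp_onD[OF nested_antisym] that by blast
    show "S = {} \<or> (\<exists>M\<in>S. \<forall>V\<in>S. V \<sqsubseteq> M)" using ex_top by blast
    show "W \<bottom> V" if "V \<in> S" "W \<in> S" "V \<bottom> W" for V W using sym that by blast
    show "V \<bottom> U" if "U \<in> S" "V \<in> S" "W \<in> S" "V \<sqsubseteq> W" "W \<bottom> U" for U V W
      using orth_nested that by blast
    show "\<exists>W\<in>S. W \<sqsubseteq> T \<and> W \<noteq> T \<and> (\<forall>V\<in>S. V \<bottom> U \<longrightarrow> V \<sqsubseteq> T \<longrightarrow> V \<sqsubseteq> W)"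
      if "T \<in> S" "U \<in> S" "V \<in> S" "U \<sqsubseteq> T" "V \<sqsubseteq> T" "V \<bottom> U" for T U V
    proof -
      have "\<exists>W\<in>below T - {T}. \<forall>V\<in>S. V \<bottom> U \<longrightarrow> V \<sqsubseteq> T \<longrightarrow> V \<sqsubseteq> W"
        by (rule orth_container) (use that in \<open>auto simp: below_def\<close>)
      then show ?thesis by (auto simp: below_def)
    qed
    show "\<not> V \<sqsubseteq> W \<and> \<not> W \<sqsubseteq> V" if "V \<in> S" "W \<in> S" "V \<bottom> W" for V W
      using orth_incomparable that by blast
    show "rk V < rk W" if "V \<in> S" "W \<in> S" "V \<sqsubseteq> W" "V \<noteq> W" for V W
      using rk that by (simp add: pnested_def)
    show "rk V \<le> n" if "V \<in> S" for V using rk that by blast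
    show "dist_at W (pt W x) (pt_rho V W) \<le> k \<or> dist_at V (pt V x) (pt_rho W V) \<le> k"
      if "V \<in> S" "W \<in> S" "\<not> V \<bottom> W" "\<not> V \<sqsubseteq> W" "\<not> W \<sqsubseteq> V" for V W x
    proof -
      have tr: "transverse V W" using that by (simp add: transverse_def)
      have "dWset W (rx x) (\<rho> V W) \<le> \<kappa>\<^sub>0 \<or> dWset V (rx x) (\<rho> W V) \<le> \<kappa>\<^sub>0"
        using consistency_transverse[OF that(1,2) tr, of "rx x"] by (simp add: min_le_iff_disj)
      then show ?thesis
        using le_dWset_rho[OF that(1,2), of x] le_dWset_rho[OF that(2,1), of x] tr tr_sym[OF that(1,2)] k(11)
        by auto
    qed
    show "dist_at W (pt W x) (pt_rho V W) \<le> k \<or> dist_at V (pt V x) (pt_sigma W V (pt W x)) \<le> k"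
      if "V \<in> S" "W \<in> S" "V \<sqsubseteq> W" "V \<noteq> W" for V W x
    proof -
      have VW: "V \<sqsubset> W" using that by (simp add: pnested_def)
      note sg = pt_sigma[OF that(1,2) VW, of "pt W x"]
      show ?thesis
        using consistency_nested[OF that(1,2) VW rx_in[of x]]
      proof
        assume "dWset W (rx x) (\<rho> V W) \<le> \<kappa>\<^sub>0"
        then show ?thesis using le_dWset_rho[OF that(1,2), of x] VW k(11) by auto
      next
        assume "diam_le (C V) (\<pi> V (rx x) \<union> (\<Union>p\<in>\<pi> W (rx x). \<sigma> W V p)) \<kappa>\<^sub>0"
        moreover have "pt_sigma W V (pt W x) \<in> (\<Union>p\<in>\<pi> W (rx x). \<sigma> W V p)"
          using sg(1) proj(1)[OF that(2), of x] that(2) by auto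
        ultimately have "mdist (C V) (pt V x) (pt_sigma W V (pt W x)) \<le> \<kappa>\<^sub>0"
          using proj(1)[OF that(1), of x] unfolding diam_le_def by blast
        moreover have "pt_sigma W V (pt W x) \<in> mspace (C V)" using sg by blast
        ultimately show ?thesis using that(1) k(12) by (simp add: dist_at)
      qed
    qed
    show "dist_at W (pt_rho U W) (pt_rho V W) \<le> k"
      if UVW: "U \<in> S" "V \<in> S" "W \<in> S" "U \<sqsubseteq> V"
        and "(V \<sqsubseteq> W \<and> V \<noteq> W) \<or> (\<not> V \<bottom> W \<and> \<not> V \<sqsubseteq> W \<and> \<not> W \<sqsubseteq> V \<and> \<not> W \<bottom> U)" for U V W
    proof -
      have V: "V \<sqsubset> W \<or> (transverse V W \<and> \<not> W \<bottom> U)"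
        using that(5) by (auto simp: pnested_def transverse_def)
      \<comment> \<open>This makes \<open>\<rho> U W\<close> meaningful:
        \<open>W \<sqsubseteq> U\<close> would give \<open>W \<sqsubseteq> V\<close>.\<close>
      have U: "U \<sqsubset> W \<or> transverse U W"
        using V UVW sym[of U W] transp_onD[OF nested_trans, of U V W] transp_onD[OF nested_trans, of W U V]
          antisymp_onD[OF nested_antisym, of U V]
        unfolding pnested_def transverse_def by blast
      have V': "V \<sqsubset> W \<or> transverse V W" using V by blast
      note pU = pt_rho[OF UVW(1,3) U] and pV = pt_rho[OF UVW(2,3) V']
      have "mdist (C W) (pt_rho U W) (pt_rho V W) \<le> \<kappa>\<^sub>0 + \<xi> + \<xi>"
        using mdist_le_set_dist[OF pU(3,2) pV(3,2) pU(1) pV(1)] consistency_\<rho>[OF UVW V] by linarith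
      moreover have "pt_rho U W \<in> mspace (C W)" "pt_rho V W \<in> mspace (C W)" using pU pV by blast+
      ultimately show ?thesis using k(11) UVW(3) by (simp add: dist_at)
    qed
    show "\<exists>\<T>. finite \<T> \<and> \<T> \<subseteq> {T\<in>S. T \<sqsubseteq> W \<and> T \<noteq> W} \<and>
          real (card \<T>) \<le> k * dist_at W (pt W x) (pt W x') + k \<and>
          (\<forall>T\<in>S. T \<sqsubseteq> W \<longrightarrow> T \<noteq> W \<longrightarrow> (\<exists>T'\<in>\<T>. T \<sqsubseteq> T') \<or> dist_at T (pt T x) (pt T x') \<le> k)"
      if W: "W \<in> S" for W x x'
    proof -
      obtain \<T> where \<T>: "\<T> \<subseteq> below W - {W}" "finite \<T>"
          "int (card \<T>) \<le> \<lfloor>\<Lambda> * dW W (rx x) (rx x') + \<Lambda>\<rfloor>"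
          "\<And>T. T \<in> below W - {W} \<Longrightarrow> (\<exists>T'\<in>\<T>. T \<in> below T') \<or> dW T (rx x) (rx x') < E1"
        using links[OF W rx_in rx_in, of x x'] by blast
      have "real (card \<T>) \<le> \<Lambda> * dW W (rx x) (rx x') + \<Lambda>" using \<T>(3) by linarith
      also have "\<dots> \<le> \<Lambda> * dist_at W (pt W x) (pt W x') + \<Lambda>"
        using dW_le[OF W, of x x'] \<Lambda> by simp
      also have "\<dots> \<le> k * dist_at W (pt W x) (pt W x') + k"
        using k(4) W by (intro add_mono mult_right_mono) (auto simp: dist_at_def)
      finally have "real (card \<T>) \<le> k * dist_at W (pt W x) (pt W x') + k" .
      moreover have "(\<exists>T'\<in>\<T>. T \<sqsubseteq> T') \<or> dist_at T (pt T x) (pt T x') \<le> k"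
        if T: "T \<in> S" "T \<sqsubseteq> W" "T \<noteq> W" for T
        using \<T>(4)[of T] T le_dW[OF T(1), of x x'] k(5) by (auto simp: below_def)
      ultimately show ?thesis using \<T>(1,2) by (intro exI[of _ \<T>]) (auto simp: below_def)
    qed
    show "dist_at V (pt_sigma W V a) (pt_sigma W V b) \<le> k \<or>
        (\<exists>z. btw (dist_at W) a z b \<and> dist_at W z (pt_rho V W) \<le> k)"
      if VS: "V \<in> S" and WS: "W \<in> S" and "V \<sqsubseteq> W" "V \<noteq> W" for V W a b
    proof -
      have VW: "V \<sqsubset> W" using that by (simp add: pnested_def)
      obtain G where G: "geodesic_segment (C W) (ret W a) (ret W b) G"
        using geodesic_C[OF WS] WS unfolding geodesic_metric_def by (meson ret_in)
      show ?thesis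
        using E2(2)[OF VS WS VW G]
      proof
        assume diam: "diam_le (C V) (\<Union>p\<in>G. \<sigma> W V p) E2"
        have "ret W a \<in> G" "ret W b \<in> G"
          using G unfolding geodesic_segment_def
          by (metis atLeastAtMost_iff imageI order_refl)+
        then have "mdist (C V) (pt_sigma W V a) (pt_sigma W V b) \<le> E2"
          using diam pt_sigma(1)[OF VS WS VW] unfolding diam_le_def by blast
        moreover have "pt_sigma W V a \<in> mspace (C V)" "pt_sigma W V b \<in> mspace (C V)"
          using pt_sigma[OF VS WS VW] by blast+
        ultimately show ?thesis using VS k(6) by (simp add: dist_at)
      next
        assume "G \<inter> nbhd (C W) E2 (\<rho> V W) \<noteq> {}"
        then obtain z u where z: "z \<in> G" "u \<in> \<rho> V W" "u \<in> mspace (C W)" "z \<in> mspace (C W)" "mdist (C W) u z \<le> E2"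
          unfolding nbhd_def by auto
        note pV = pt_rho[OF VS WS disjI1[OF VW]]
        have "mdist (C W) u (pt_rho V W) \<le> \<xi>" using pV z(2) unfolding diam_le_def by blast
        moreover have M: "pt_rho V W \<in> mspace (C W)" using pV by blast
        ultimately have "mdist (C W) z (pt_rho V W) \<le> k"
          using mdist_triangle[OF z(4,3) M] z(5) k(7) mdist_commute[of "C W" u z] by linarith
        then show ?thesis using btw_seg[OF WS G z(1)] z(4) M WS by (auto simp: dist_at)
      qed
    qed
    show "\<exists>x. (\<forall>V\<in>F. dist_at V (pt V x) (pt V (z V)) \<le> k) \<and>
            (\<forall>V\<in>F. \<forall>W\<in>S. (V \<sqsubseteq> W \<and> V \<noteq> W) \<or> (\<not> V \<bottom> W \<and> \<not> V \<sqsubseteq> W \<and> \<not> W \<sqsubseteq> V) \<longrightarrow>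
               dist_at W (pt W x) (pt_rho V W) \<le> k)"
      if F: "F \<subseteq> S" "pairwise (\<bottom>) F" for F z
    proof -
      have im: "\<forall>V\<in>F. pt V (z V) \<in> image_proj V"
        using proj(1) F(1) rx_in unfolding image_proj_def by blast
      then obtain x where x: "x \<in> mspace X" "\<And>V. V \<in> F \<Longrightarrow> dWset V x {pt V (z V)} \<le> \<alpha>"
          "\<And>V W. V \<in> F \<Longrightarrow> W \<in> S \<Longrightarrow> V \<sqsubset> W \<or> transverse W V \<Longrightarrow> dWset W x (\<rho> V W) \<le> \<alpha>"
        using \<alpha>[THEN spec, THEN mp, OF F(1), THEN spec, THEN mp, OF F(2), THEN mp, OF im] by blast
      have "dist_at V (pt V x) (pt V (z V)) \<le> k" if "V \<in> F" for V
      proof -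
        have V: "V \<in> S" using that F by blast
        have "mdist (C V) (pt V x) (pt V (z V)) \<le> set_dist (C V) (\<pi> V (rx x)) {pt V (z V)} + \<xi> + 0"
          using V by (intro mdist_le_set_dist[OF proj(3,2)[OF V] _ _ proj(1)[OF V]])
            (auto simp: diam_le_singleton)
        then show ?thesis using x(1) x(2)[OF that] k(9) V by (simp add: dWset_def dist_at)
      qed
      moreover have "dist_at W (pt W x) (pt_rho V W) \<le> k"
        if "V \<in> F" "W \<in> S" "(V \<sqsubseteq> W \<and> V \<noteq> W) \<or> (\<not> V \<bottom> W \<and> \<not> V \<sqsubseteq> W \<and> \<not> W \<sqsubseteq> V)" for V W
      proof -
        have V: "V \<in> S" using that F by blast
        have VW: "V \<sqsubset> W \<or> transverse V W" using that(3) by (simp add: pnested_def transverse_def)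
        then have "dWset W x (\<rho> V W) \<le> \<alpha>" using x(3)[OF that(1,2)] tr_sym[OF V that(2)] by blast
        then show ?thesis using le_dWset_rho[OF V that(2) VW, of x] x(1) k(8) by simp
      qed
      ultimately show ?thesis by blast
    qed
    show "mdist X (rx x) (rx x) = 0" for x by simp
    show "mdist X (rx x) (rx y) = mdist X (rx y) (rx x)" for x y by (rule mdist_commute)
    show "mdist X (rx x) (rx z) \<le> mdist X (rx x) (rx y) + mdist X (rx y) (rx z)" for x y z
      by (intro mdist_triangle) auto
    show "dist_at W (pt W x) (pt W y) \<le> k * mdist X (rx x) (rx y) + k" if "W \<in> S" for W x y
      using le_dW[OF that, of x y] K(2)[OF that rx_in rx_in, of x y] k(2)
        mult_right_mono[OF k(3), of "mdist X (rx x) (rx y)"] by simp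
    show "\<exists>z. dist_at W (pt W z) m \<le> k" if W: "W \<in> S" and m: "btw (dist_at W) (pt W x) m (pt W y)" for W x y m
    proof -
      obtain G where G: "geodesic_segment (C W) (ret W (pt W x)) (ret W (pt W y)) G" "ret W m \<in> G"
        using through[OF W m] by blast
      have "pt W v \<in> image_proj W" for v
        using proj(1)[OF W] rx_in unfolding image_proj_def by blast
      then have "G \<subseteq> nbhd (C W) K (image_proj W)"
        using K(3)[OF W] G(1) unfolding quasiconvex_def ret_id[OF pt_in[OF W]] by blast
      then obtain z u where z: "z \<in> mspace X" "u \<in> \<pi> W z" "u \<in> mspace (C W)" "mdist (C W) u (ret W m) \<le> K"
        using G(2) unfolding nbhd_def image_proj_def by auto
      have "mdist (C W) (pt W z) u \<le> \<xi>"
        using proj(1,3)[OF W, of z] z(1,2) unfolding diam_le_def by auto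
      then have "mdist (C W) (pt W z) (ret W m) \<le> k"
        using mdist_triangle[OF pt_in[OF W, of z] z(3) ret_in[OF W, of m]] z(4) k(13) by linarith
      then show ?thesis using W by (auto simp: dist_at_def)
    qed
    show "slim (dist_at W) k" if VS: "V \<in> S" and WS: "W \<in> S" and VW: "V \<sqsubseteq> W" "V \<noteq> W" for V W
      unfolding slim_def
    proof (intro allI impI)
      fix a m b z assume "btw (dist_at W) a m b"
      then obtain G1 where G1: "geodesic_segment (C W) (ret W a) (ret W b) G1" "ret W m \<in> G1"
        using through WS by blast
      obtain G2 G3 where G: "geodesic_segment (C W) (ret W b) (ret W z) G2"
          "geodesic_segment (C W) (ret W z) (ret W a) G3"
        using geodesic_C[OF WS] WS unfolding geodesic_metric_def by (meson ret_in)
      have "hyperbolic \<delta> (C W)"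
        using minimal_or_hyperbolic[OF WS] VS VW unfolding minimal_def by blast
      then have "G1 \<subseteq> nbhd (C W) \<delta> (G2 \<union> G3)"
        using G1 G unfolding hyperbolic_def by blast
      then obtain w where w0: "w \<in> G2 \<union> G3" "ret W m \<in> mcball_of (C W) w \<delta>"
        using G1(2) unfolding nbhd_def by blast
      then have w: "w \<in> G2 \<union> G3" "w \<in> mspace (C W)" "mdist (C W) w (ret W m) \<le> \<delta>"
        by simp_all
      have "btw (dist_at W) a w z \<or> btw (dist_at W) b w z"
        using w(1) btw_seg[OF WS G(1)] btw_seg[OF WS G(2)]
          geodesic_pseudometric.btw_sym[OF geodesic_pseudometric_dist_at] by blast
      moreover have "dist_at W m w \<le> k"
        using w WS k(10) by (simp add: dist_at_def mdist_commute)
      ultimately show "\<exists>w. (btw (dist_at W) a w z \<or> btw (dist_at W) b w z) \<and> dist_at W m w \<le> k" by blast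
    qed
    show "\<exists>\<theta>. \<forall>x y. (\<forall>V\<in>S. dist_at V (pt V x) (pt V y) \<le> c) \<longrightarrow> mdist X (rx x) (rx y) \<le> \<theta>" for c
    proof -
      \<comment> \<open>Uniqueness takes a nonnegative threshold; the added 1 makes it exceed
        \<open>c\<close>.\<close>
      obtain \<theta> where \<theta>: "\<And>x y. x \<in> mspace X \<Longrightarrow> y \<in> mspace X \<Longrightarrow> \<theta> \<le> mdist X x y \<Longrightarrow> \<exists>V\<in>S. max 0 c + 1 \<le> dW V x y"
        using uniqueness[of "max 0 c + 1"] by auto
      have "mdist X (rx x) (rx y) \<le> \<theta>" if "\<forall>V\<in>S. dist_at V (pt V x) (pt V y) \<le> c" for x y
      proof (rule ccontr)
        assume "\<not> ?thesis"
        then obtain V where "V \<in> S" "max 0 c + 1 \<le> dW V (rx x) (rx y)"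
          using \<theta>[OF rx_in rx_in, of x y] by auto
        then show False using that dW_le[of V x y] by fastforce
      qed
      then show ?thesis by blast
    qed
    show "\<exists>(m::nat) c. c 0 = x \<and> c m = y \<and> real m \<le> k * mdist X (rx x) (rx y) + k \<and>
          (\<forall>i<m. mdist X (rx (c i)) (rx (c (Suc i))) \<le> k)" for x y
    proof -
      obtain l f where f: "quasigeodesic q X l f" "joins l f (rx x) (rx y)"
        using q rx_in unfolding quasigeodesic_metric_def by blast
      obtain m c where c: "c 0 = rx x" "c m = rx y" "real m \<le> q * mdist X (rx x) (rx y) + q * q + 1"
          "\<And>i. i \<le> m \<Longrightarrow> c i \<in> mspace X" "\<And>i. i < m \<Longrightarrow> mdist X (c i) (c (Suc i)) \<le> 4 * q"
        using quasigeodesic_chain[OF f] by blast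
      \<comment> \<open>The ends must be \<open>x\<close> and \<open>y\<close> themselves, even
        outside the carrier, so the chain for \<open>rx x\<close> and \<open>rx y\<close> gets one
        more step, of length zero. It also keeps the ends apart if \<open>m = 0\<close>, and is paid
        for by \<open>q * q + 2 \<le> k\<close>.\<close>
      define c' where "c' i = (if i = 0 then x else if i = Suc m then y else c i)" for i
      have rx_c': "rx (c' i) = c (min i m)" if "i \<le> Suc m" for i
        using c that by (auto simp: c'_def min_def le_Suc_eq)
      have "mdist X (rx (c' i)) (rx (c' (Suc i))) \<le> k" if "i < Suc m" for i
      proof (cases "i = m")
        case True
        have "mdist X (c m) (c m) = 0" using c(4)[of m] by simp
        then have "mdist X (c m) (c m) \<le> k" using k(1) by linarith
        then show ?thesis using rx_c'[of i] rx_c'[of "Suc i"] True by simp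
      next
        case False
        then show ?thesis using rx_c'[of i] rx_c'[of "Suc i"] c(5)[of i] k(14) that by (simp add: min_def)
      qed
      moreover have "real (Suc m) \<le> k * mdist X (rx x) (rx y) + k"
        using c(3) k(16) mult_right_mono[OF k(15), of "mdist X (rx x) (rx y)"] by simp
      ultimately show ?thesis
        by (intro exI[of _ "Suc m"] exI[of _ c']) (auto simp: c'_def)
    qed
  qed
qed

lemma hierarchy_paths:
  "\<exists>D\<ge>0. \<forall>x\<in>mspace X. \<forall>y\<in>mspace X. \<exists>l \<gamma>. quasigeodesic D X l \<gamma> \<and> joins l \<gamma> x y \<and>
     (\<forall>U\<in>S. unparam_quasigeodesic D (C U) l (\<lambda>t. \<Union>p\<in>\<gamma> t. \<pi> U p))"
proof -
  obtain k rk n where "coarse_hierarchy S (\<sqsubseteq>) (\<bottom>) (\<lambda>x y. mdist X (rx x) (rx y)) dist_at pt pt_rho pt_sigma k rk n"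
    using ex_coarse_hierarchy by blast
  from coarse_hierarchy.hierarchy_chain[OF this] obtain D where D: "1 \<le> D"
      "\<And>x y. \<exists>m h. h 0 = x \<and> h m = y \<and> quasi_chain D (\<lambda>x y. mdist X (rx x) (rx y)) m h \<and>
       (\<forall>W\<in>S. \<exists>K \<iota>. \<iota> 0 = 0 \<and> \<iota> K = m \<and> (\<forall>i<K. \<iota> i < \<iota> (Suc i)) \<and>
          quasi_chain D (dist_at W) K (\<lambda>i. pt W (h (\<iota> i))))"
    by blast
  \<comment> \<open>One constant for both step functions: singletons in \<open>X\<close>, and sets
    of diameter at most \<open>\<xi>\<close> in \<open>C U\<close>.\<close>
  define B where "B = 2 * D + 2 * \<xi> + 1"
  have "\<exists>l \<gamma>. quasigeodesic B X l \<gamma> \<and> joins l \<gamma> x y \<and>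
      (\<forall>U\<in>S. unparam_quasigeodesic B (C U) l (\<lambda>t. \<Union>p\<in>\<gamma> t. \<pi> U p))"
    if xy: "x \<in> mspace X" "y \<in> mspace X" for x y
  proof -
    obtain m h where h: "h 0 = x" "h m = y" "quasi_chain D (\<lambda>x y. mdist X (rx x) (rx y)) m h"
      and W: "\<And>W. W \<in> S \<Longrightarrow> \<exists>K \<iota>. \<iota> 0 = 0 \<and> \<iota> K = m \<and> (\<forall>i<K. \<iota> i < \<iota> (Suc i)) \<and>
          quasi_chain D (dist_at W) K (\<lambda>i. pt W (h (\<iota> i)))"
      using D(2)[of x y] by blast
    let ?\<gamma> = "\<lambda>t. {rx (h (nat \<lfloor>t\<rfloor>))}"
    have "quasi_chain D (mdist X) m (\<lambda>i. rx (h i))"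
      using h(3) by (simp add: quasi_chain_def)
    then have "quasigeodesic B X (real m) ?\<gamma>"
      using D(1) \<xi>_nonneg
      by (intro quasigeodesic_floor[where A = "\<lambda>i. {rx (h i)}" and r = 0]) (auto simp: diam_le_singleton B_def)
    moreover have "joins (real m) ?\<gamma> x y"
      using h xy by (simp add: joins_def)
    moreover have "unparam_quasigeodesic B (C U) (real m) (\<lambda>t. \<Union>p\<in>?\<gamma> t. \<pi> U p)" if U: "U \<in> S" for U
    proof -
      obtain K \<iota> where \<iota>: "\<iota> 0 = 0" "\<iota> K = m" "\<And>i. i < K \<Longrightarrow> \<iota> i < \<iota> (Suc i)"
          "quasi_chain D (dist_at U) K (\<lambda>i. pt U (h (\<iota> i)))"
        using W[OF U] by blast
      have "quasi_chain D (mdist (C U)) K (\<lambda>i. pt U (h (\<iota> i)))"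
        using \<iota>(4) U by (simp add: quasi_chain_def dist_at)
      then have "unparam_quasigeodesic B (C U) (real m) (\<lambda>t. \<pi> U (rx (h (nat \<lfloor>t\<rfloor>))))"
        using D(1) proj[OF U] \<iota>(1-3)
        by (intro unparam_quasigeodesic_floor[where A = "\<lambda>i. \<pi> U (rx (h i))" and r = \<xi>
              and D = D and p = "\<lambda>i. pt U (h i)" and \<iota> = \<iota> and K = K]) (auto simp: B_def)
      then show ?thesis by simp
    qed
    ultimately show ?thesis by blast
  qed
  moreover have "0 \<le> B" using D(1) \<xi>_nonneg by (simp add: B_def)
  ultimately show ?thesis by blast
qed

end

theorem theorem6p11:
  fixes X :: "'x metric"
    and S :: "'s set"
    and nested orth :: "'s \<Rightarrow> 's \<Rightarrow> bool"
    and C :: "'s \<Rightarrow> 'c metric"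
    and \<pi> :: "'s \<Rightarrow> 'x \<Rightarrow> 'c set"
    and \<rho> :: "'s \<Rightarrow> 's \<Rightarrow> 'c set"
    and \<sigma> :: "'s \<Rightarrow> 's \<Rightarrow> 'c \<Rightarrow> 'c set"
  assumes "hierarchical_data.relatively_hierarchically_hyperbolic X S nested orth C \<pi> \<rho> \<sigma>"
  shows "\<exists>D\<ge>0. \<forall>x\<in>mspace X. \<forall>y\<in>mspace X.
           \<exists>l \<gamma>. quasigeodesic D X l \<gamma> \<and> joins l \<gamma> x y \<and>
             (\<forall>U\<in>S. unparam_quasigeodesic D (C U) l (\<lambda>t. \<Union>p\<in>\<gamma> t. \<pi> U p))"
proof (cases "mspace X = {}")
  case False
  \<comment> \<open>A base point, the default value for points outside the carrier.\<close>
  then obtain x0 where x0: "x0 \<in> mspace X" by blast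
  obtain \<xi> \<kappa>\<^sub>0 \<delta> where hs: "hierarchical_space X S nested orth C \<pi> \<rho> \<sigma> \<xi> \<kappa>\<^sub>0"
      and hyp: "\<And>U. U \<in> S \<Longrightarrow> hierarchical_data.minimal S nested U \<or> hyperbolic \<delta> (C U)"
    using assms unfolding hierarchical_data.relatively_hierarchically_hyperbolic_def by blast
  interpret pointed_hierarchical_space X S nested orth C \<pi> \<rho> \<sigma> \<xi> \<kappa>\<^sub>0 x0 \<delta>
    by (intro pointed_hierarchical_space.intro hs pointed_hierarchical_space_axioms.intro x0 hyp)
  show ?thesis by (rule hierarchy_paths)
qed auto

end
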